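(* Let $\rho>0$ and let $(z_k)_{k\in\mathbb{N}}$ be a sequence of distinct complex numbers in the unit disc $\mathbb{D}$ for which there is a constant $C>0$ such that $$N_{z_k}\Bigl(\frac{1-|z_k|}{2}\Bigr)\le C\Bigl(\frac{1}{1-|z_k|}\Bigr)^{\rho}\quad\text{for all } k\in\mathbb{N}.$$ Then there exist a function $a$ analytic in $\mathbb{D}$ and a constant $C'>0$ with $\ln M(r,a)\le C'(1-r)^{-\rho}$ for all $r\in(0,1)$, such that the differential equation $f''+a(z)f=0$ possesses a solution $f$, analytic in $\mathbb{D}$, having zeros precisely at the points $z_k$, $k\in\mathbb{N}$.
   Context: $\mathbb{D}=\{z\in\mathbb{C}:|z|<1\}$. For $g$ analytic in $\mathbb{D}$ and $r\in(0,1)$, $M(r,g)=\max\{|g(z)|:|z|=r\}$ (with $\ln 0=-\infty$). For a sequence $(z_k)$ in $\mathbb{D}$, $\zeta\in\mathbb{D}$ and $t\ge0$, $n_\zeta(t)$ is the number of members $z_k$ of the sequence with $|z_k-\zeta|\le t$, and $N_\zeta(r)=\int_0^r\frac{(n_\zeta(t)-1)^+}{t}\,dt$, where $x^+=\max\{x,0\}$. *)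

theory Defs
  imports "HOL-Complex_Analysis.Complex_Analysis"
begin

text \<open>
  The counting function takes values in the extended nonnegative reals, so that it is
  \<open>\<infinity>\<close> (rather than \<open>0\<close>, as with \<^const>\<open>card\<close>) when infinitely many members of the
  sequence lie in the closed disc.
\<close>

definition count_disc :: "(nat \<Rightarrow> complex) \<Rightarrow> complex \<Rightarrow> real \<Rightarrow> ennreal" where
  "count_disc z \<zeta> t = emeasure (count_space UNIV) {k. cmod (z k - \<zeta>) \<le> t}"

text \<open>
  Subtraction on \<^typ>\<open>ennreal\<close> is truncated at \<open>0\<close>, so \<open>n - 1\<close> is the positive part
  \<open>(n - 1)\<^sup>+\<close>.  The Lebesgue integral of this nonnegative function is allowed to be \<open>\<infinity>\<close>.
\<close>

definition integrated_count :: "(nat \<Rightarrow> complex) \<Rightarrow> complex \<Rightarrow> real \<Rightarrow> ennreal" where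
  "integrated_count z \<zeta> r =
     (\<integral>\<^sup>+t\<in>{0<..r}. ((count_disc z \<zeta> t - 1) / ennreal t) \<partial>lborel)"

text \<open>For continuous \<open>g\<close> and \<open>r \<ge> 0\<close> the supremum is attained, i.e. it is the maximum.\<close>

definition max_modulus :: "real \<Rightarrow> (complex \<Rightarrow> complex) \<Rightarrow> real" where
  "max_modulus r g = (SUP z\<in>sphere 0 r. cmod (g z))"

text \<open>The library has \<open>ln 0 = 0\<close>; here \<open>ln 0 = -\<infinity>\<close>.\<close>

definition ln_ext :: "real \<Rightarrow> ereal" where
  "ln_ext x = (if x = 0 then -\<infinity> else ereal (ln x))"

end

theory Submission imports Defs begin

text \<open>
  The solution is sought in the form \<open>f = P * exp g\<close>, where \<open>P\<close> is a product with simple zeros exactly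
  at the points \<open>z k\<close>.  With \<open>h = g'\<close> the equation forces
  \<open>a = - ((P'' + 2 * h * P') / P + h\<^sup>2 + h')\<close>, so \<open>a\<close> is holomorphic if \<open>h\<close> takes the value
  \<open>- P'' / (2 * P')\<close> at every zero of \<open>P\<close>.  Two things remain: to interpolate these values by a
  function \<open>h\<close> with \<open>ln |h(w)| \<le> C (1 - |w|)\<^sup>-\<^sup>\<rho>\<close>, and to bound the quotient by \<open>P\<close>.  Functions with
  such a bound (\<open>moderate_growth\<close>) form an algebra closed under differentiation.

  The hypothesis on the sequence is used through finite sums: for the points \<open>z j\<close> within
  \<open>\<delta> k / 2\<close> of \<open>z k\<close>, where \<open>\<delta> k = 1 - |z k|\<close>, the sum of \<open>ln (\<delta> k / (2 |z j - z k|))\<close> is at most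
  \<open>C (\<delta> k)\<^sup>-\<^sup>\<rho>\<close> (\<open>sum_ln_le_integrated_count\<close>).  In particular a disc of radius comparable to its distance
  \<open>\<delta>\<close> from the circle contains \<open>O(\<delta>\<^sup>-\<^sup>\<rho>)\<close> points, and summing over dyadic shells gives
  \<open>\<Sum>j. (\<delta> j / |1 - cnj (z j) * w|) ^ m \<le> K (1 - |w|)\<^sup>-\<^sup>\<rho>\<close> for a suitable \<open>m\<close> (\<open>kernel_sum_bound\<close>).

  This sum controls the canonical product \<open>P\<close> of Weierstrass factors of genus \<open>m - 1\<close> in which
  \<open>1 - A k\<close> is a Blaschke factor.  With \<open>S\<close> a constant multiple of the sum at \<open>w\<close>,
  \<open>|P(w)|\<close> is at most \<open>exp S\<close>, and it is at least \<open>exp (- S)\<close> times the moduli of the Blaschke factors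
  of the zeros close to \<open>w\<close> (\<open>canonical_estimates\<close>).  At a zero, where one factor is omitted, the logarithmic sums
  bound these remaining Blaschke factors, which gives a lower bound for \<open>|P'(z k)|\<close> and hence an upper
  bound for the values to be interpolated.

  Interpolation (lemma \<open>interpolation\<close>) is done by a Lagrange series whose terms are multiplied by
  high powers of \<open>(1 - |z k|\<^sup>2) / (1 - cnj (z k) * w)\<close>.  For division (lemma \<open>division\<close>) the numerator
  is compared, by the maximum principle, with the polynomial that has the zeros near \<open>w\<close>; the lower
  bound for \<open>P\<close> contains the same polynomial, so no exceptional set around the zeros has to be excluded.
\<close>

section \<open>Functions of moderate growth in the disc\<close>

text \<open>
  Polynomial blow-up at the boundary is invisible on the scale \<open>exp (C * x powr (-\<rho>))\<close>, where \<open>x\<close> is the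
  distance to the circle.  This is why Cauchy estimates and polynomial numbers of terms cost only a
  larger constant \<open>C\<close>.
\<close>

lemma powr_minus_le_exp:
  fixes \<rho> \<kappa> x :: real
  assumes "\<rho> > 0" "\<kappa> \<ge> 0" "0 < x"
  shows "x powr (-\<kappa>) \<le> exp (\<kappa> / \<rho> * x powr (-\<rho>))"
proof -
  have "-\<rho> * ln x = ln (x powr (-\<rho>))"
    using assms by (simp add: ln_powr)
  also have "\<dots> \<le> x powr (-\<rho>)"
    using ln_le_minus_one[of "x powr (-\<rho>)"] assms by simp
  finally have "\<kappa> / \<rho> * (-\<rho> * ln x) \<le> \<kappa> / \<rho> * x powr (-\<rho>)"
    using assms by (intro mult_left_mono) auto
  moreover have "\<kappa> / \<rho> * (-\<rho> * ln x) = -\<kappa> * ln x"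
    using assms by simp
  ultimately show ?thesis
    using assms by (simp add: powr_def)
qed

lemma powr_minus_ge_1:
  fixes \<rho> x :: real
  assumes "\<rho> \<ge> 0" "0 < x" "x \<le> 1"
  shows "1 \<le> x powr (-\<rho>)"
  using assms by (simp add: powr_minus one_le_inverse_iff powr_le1)

definition moderate_growth :: "real \<Rightarrow> (complex \<Rightarrow> complex) \<Rightarrow> bool" where
  "moderate_growth \<rho> f \<longleftrightarrow> f holomorphic_on ball 0 1 \<and>
     (\<exists>C. \<forall>w\<in>ball 0 1. cmod (f w) \<le> exp (C * (1 - cmod w) powr (-\<rho>)))"

lemma moderate_growthI:
  assumes "f holomorphic_on ball 0 1"
    and "\<And>w. cmod w < 1 \<Longrightarrow> cmod (f w) \<le> exp (C * (1 - cmod w) powr (-\<rho>))"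
  shows "moderate_growth \<rho> f"
  using assms unfolding moderate_growth_def by (auto intro!: exI[of _ C])

lemma moderate_growthE:
  assumes "moderate_growth \<rho> f"
  obtains C where "C > 0" "\<And>w. cmod w < 1 \<Longrightarrow> cmod (f w) \<le> exp (C * (1 - cmod w) powr (-\<rho>))"
proof -
  obtain C where C: "\<And>w. cmod w < 1 \<Longrightarrow> cmod (f w) \<le> exp (C * (1 - cmod w) powr (-\<rho>))"
    using assms unfolding moderate_growth_def by (metis mem_ball_0)
  have "cmod (f w) \<le> exp ((\<bar>C\<bar> + 1) * (1 - cmod w) powr (-\<rho>))" if "cmod w < 1" for w
    by (rule order_trans[OF C[OF that]]) (auto intro!: mult_right_mono)
  thus ?thesis by (intro that[of "\<bar>C\<bar> + 1"]) auto
qed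

lemma moderate_growth_holomorphic: "moderate_growth \<rho> f \<Longrightarrow> f holomorphic_on ball 0 1"
  by (simp add: moderate_growth_def)

lemma moderate_growth_mult:
  assumes "moderate_growth \<rho> f" "moderate_growth \<rho> g"
  shows "moderate_growth \<rho> (\<lambda>w. f w * g w)"
proof -
  obtain C D where
    "\<And>w. cmod w < 1 \<Longrightarrow> cmod (f w) \<le> exp (C * (1 - cmod w) powr (-\<rho>))"
    "\<And>w. cmod w < 1 \<Longrightarrow> cmod (g w) \<le> exp (D * (1 - cmod w) powr (-\<rho>))"
    using assms by (metis moderate_growthE)
  thus ?thesis
    using assms[THEN moderate_growth_holomorphic]
    by (intro moderate_growthI[where C = "C + D"])
       (auto intro!: holomorphic_intros simp: norm_mult ring_distribs exp_add mult_mono)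
qed

lemma moderate_growth_const:
  assumes "\<rho> > 0"
  shows "moderate_growth \<rho> (\<lambda>w. c)"
proof (rule moderate_growthI[where C = "cmod c"])
  fix w :: complex assume "cmod w < 1"
  hence "cmod c * 1 \<le> cmod c * (1 - cmod w) powr (-\<rho>)"
    using assms by (intro mult_left_mono powr_minus_ge_1) auto
  thus "cmod c \<le> exp (cmod c * (1 - cmod w) powr (-\<rho>))"
    using exp_ge_add_one_self[of "cmod c * (1 - cmod w) powr (-\<rho>)"] by linarith
qed (rule holomorphic_on_const)

lemma moderate_growth_add:
  assumes "\<rho> > 0" "moderate_growth \<rho> f" "moderate_growth \<rho> g"
  shows "moderate_growth \<rho> (\<lambda>w. f w + g w)"
proof -
  obtain C D where CD: "C > 0" "D > 0"
    "\<And>w. cmod w < 1 \<Longrightarrow> cmod (f w) \<le> exp (C * (1 - cmod w) powr (-\<rho>))"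
    "\<And>w. cmod w < 1 \<Longrightarrow> cmod (g w) \<le> exp (D * (1 - cmod w) powr (-\<rho>))"
    using assms(2,3) by (metis moderate_growthE)
  show ?thesis
  proof (rule moderate_growthI[where C = "C + D + 1"])
    show "(\<lambda>w. f w + g w) holomorphic_on ball 0 1"
      using assms(2,3)[THEN moderate_growth_holomorphic] by (intro holomorphic_intros)
  next
    fix w :: complex assume w: "cmod w < 1"
    define y where "y = (1 - cmod w) powr (-\<rho>)"
    have y: "y \<ge> 1" unfolding y_def using w assms by (intro powr_minus_ge_1) auto
    have "cmod (f w + g w) \<le> exp (C * y) + exp (D * y)"
      using CD(3,4)[OF w] norm_triangle_ineq[of "f w" "g w"] by (simp add: y_def)
    also have "\<dots> \<le> exp ((C + D) * y) + exp ((C + D) * y)"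
      using y CD by (intro add_mono) auto
    also have "\<dots> = 2 * exp ((C + D) * y)" by simp
    also have "\<dots> \<le> exp y * exp ((C + D) * y)"
      by (rule mult_right_mono) (use exp_ge_add_one_self[of y] y in linarith, simp)
    also have "\<dots> = exp ((C + D + 1) * y)"
      by (simp add: exp_add [symmetric] ring_distribs)
    finally show "cmod (f w + g w) \<le> exp ((C + D + 1) * (1 - cmod w) powr (-\<rho>))"
      by (simp add: y_def)
  qed
qed

lemma moderate_growth_uminus:
  assumes "moderate_growth \<rho> f"
  shows "moderate_growth \<rho> (\<lambda>w. - f w)"
  using assms unfolding moderate_growth_def by (auto intro!: holomorphic_intros)

lemma half_powr_minus:
  fixes x \<rho> :: real
  assumes "0 < x" "\<rho> > 0" "y \<ge> x / 2"
  shows "y powr (-\<rho>) \<le> 2 powr \<rho> * x powr (-\<rho>)"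
proof -
  have "y powr (-\<rho>) \<le> (x / 2) powr (-\<rho>)"
    using assms by (intro powr_mono2') auto
  also have "\<dots> = 2 powr \<rho> * x powr (-\<rho>)"
    using assms by (simp add: powr_divide powr_minus field_simps)
  finally show ?thesis .
qed

text \<open>
  Cauchy's estimate on the disc about \<open>w\<close> of half the distance to the circle: there \<open>1 - cmod v\<close>
  drops at most by the factor \<open>2\<close>, and the factor \<open>2 / (1 - cmod w)\<close> is absorbed by the exponential.
\<close>

lemma moderate_growth_deriv:
  assumes "\<rho> > 0" "moderate_growth \<rho> f"
  shows "moderate_growth \<rho> (deriv f)"
proof -
  note holo = moderate_growth_holomorphic[OF assms(2)]
  obtain C where C: "C > 0" "\<And>w. cmod w < 1 \<Longrightarrow> cmod (f w) \<le> exp (C * (1 - cmod w) powr (-\<rho>))"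
    using assms(2) by (metis moderate_growthE)
  show ?thesis
  proof (rule moderate_growthI[where C = "C * 2 powr \<rho> + 1 + 1 / \<rho>"])
    show "deriv f holomorphic_on ball 0 1"
      using holo by (intro holomorphic_deriv) auto
  next
    fix w :: complex assume w: "cmod w < 1"
    define x where "x = 1 - cmod w"
    have x: "0 < x" "x \<le> 1" using w by (auto simp: x_def)
    define y where "y = x powr (-\<rho>)"
    have y: "y \<ge> 1" unfolding y_def using x assms by (intro powr_minus_ge_1) auto
    have in_disc: "cmod v < 1 \<and> 1 - cmod v \<ge> x / 2" if "cmod (w - v) \<le> x / 2" for v
      using that norm_triangle_ineq2[of v w] x by (simp add: x_def norm_minus_commute)
    hence sub: "cball w (x / 2) \<subseteq> ball 0 1" by (auto simp: dist_norm)
    have "cmod ((deriv ^^ 1) f w) \<le> fact 1 * exp (C * 2 powr \<rho> * y) / (x / 2) ^ 1"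
    proof (rule Cauchy_inequality)
      show "f holomorphic_on ball w (x / 2)" "continuous_on (cball w (x / 2)) f"
        using holo sub ball_subset_cball
        by (meson holomorphic_on_subset holomorphic_on_imp_continuous_on order_trans)+
      fix v assume v: "cmod (w - v) = x / 2"
      have "(1 - cmod v) powr (-\<rho>) \<le> 2 powr \<rho> * y"
        unfolding y_def using in_disc[of v] v x assms by (intro half_powr_minus) auto
      hence "C * (1 - cmod v) powr (-\<rho>) \<le> C * 2 powr \<rho> * y"
        using C(1) by (simp add: mult.assoc)
      thus "cmod (f v) \<le> exp (C * 2 powr \<rho> * y)"
        using C(2)[of v] in_disc[of v] v
        by (metis exp_le_cancel_iff order.refl order_trans)
    qed (use x in auto)
    also have "\<dots> = 2 * x powr (-1) * exp (C * 2 powr \<rho> * y)"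
      using x by (simp add: powr_minus field_simps)
    also have "\<dots> \<le> exp y * exp (1 / \<rho> * y) * exp (C * 2 powr \<rho> * y)"
    proof (intro mult_mono)
      show "2 \<le> exp y" using exp_ge_add_one_self[of y] y by linarith
      show "x powr (-1) \<le> exp (1 / \<rho> * y)"
        using powr_minus_le_exp[of \<rho> 1 x] x assms by (simp add: y_def)
    qed auto
    also have "\<dots> = exp ((C * 2 powr \<rho> + 1 + 1 / \<rho>) * y)"
      by (simp add: exp_add [symmetric] algebra_simps)
    finally show "cmod (deriv f w) \<le> exp ((C * 2 powr \<rho> + 1 + 1 / \<rho>) * (1 - cmod w) powr (-\<rho>))"
      by (simp add: y_def x_def)
  qed
qed

lemma holomorphic_uniform_limit_disc:
  fixes g :: "complex \<Rightarrow> complex"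
  assumes "\<And>n. f n holomorphic_on ball 0 1"
    and lim: "\<And>r. r < 1 \<Longrightarrow> uniform_limit (cball 0 r) f g sequentially"
  shows "g holomorphic_on ball 0 1"
proof (rule holomorphic_uniform_sequence[where f = f])
  fix x :: complex assume "x \<in> ball 0 1"
  define d where "d = (1 - cmod x) / 2"
  have d: "d > 0" using \<open>x \<in> ball 0 1\<close> by (simp add: d_def)
  have sub: "cball x d \<subseteq> cball 0 (cmod x + d)"
    by (simp add: cball_subset_cball_iff)
  have "cmod x + d < 1" using \<open>x \<in> ball 0 1\<close> by (simp add: d_def field_simps)
  hence "uniform_limit (cball x d) f g sequentially" "cball x d \<subseteq> ball 0 1"
    using sub lim uniform_limit_on_subset by (blast, fastforce)
  thus "\<exists>d>0. cball x d \<subseteq> ball 0 1 \<and> uniform_limit (cball x d) f g sequentially"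
    using d by blast
qed (use assms in auto)

section \<open>Counting the points of the sequence\<close>

lemma power_powr_commute:
  fixes x :: real
  assumes "x \<ge> 0"
  shows "(x ^ n) powr a = (x powr a) ^ n"
  using assms by (induction n) (auto simp: powr_mult)

lemma dyadic_index:
  fixes x :: real
  assumes "x \<ge> 1"
  obtains i :: nat where "2 ^ i \<le> x" "x < 2 ^ Suc i"
proof -
  define n where "n = nat \<lfloor>log 2 x\<rfloor>"
  have "log 2 x \<ge> 0" using assms by simp
  hence n: "real n \<le> log 2 x" "log 2 x < real (Suc n)"
    unfolding n_def by linarith+
  have "2 powr real n \<le> x" using n(1) assms by (subst le_log_iff [symmetric]) auto
  moreover have "x < 2 powr real (Suc n)" using n(2) assms by (subst log_less_iff [symmetric]) auto
  ultimately show ?thesis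
    using that[of n] by (simp only: powr_realpow zero_less_numeral)
qed

text \<open>
  The assumption \<open>log_sum_le\<close> is what a bound for the integrated counting function says about single
  points, because \<open>ln (r / d)\<close> is the integral of \<open>1 / t\<close> from \<open>d\<close> to \<open>r\<close>.  Stated for finite sets of
  indices it makes no reference to measures.
\<close>

locale sparse_sequence =
  fixes \<rho> C :: real and z :: "nat \<Rightarrow> complex"
  assumes rho: "\<rho> > 0" and C_pos: "C > 0" and inj: "inj z" and in_disc: "cmod (z k) < 1"
    and log_sum_le: "\<lbrakk>finite J; k \<notin> J; \<And>j. j \<in> J \<Longrightarrow> cmod (z j - z k) \<le> (1 - cmod (z k)) / 2\<rbrakk> \<Longrightarrow>
      (\<Sum>j\<in>J. ln ((1 - cmod (z k)) / (2 * cmod (z j - z k)))) \<le> C * (1 - cmod (z k)) powr (-\<rho>)"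
begin

definition \<delta> :: "nat \<Rightarrow> real" where "\<delta> k = 1 - cmod (z k)"

text \<open>
  \<open>D k w\<close> is comparable to the largest of \<open>\<delta> k\<close>, \<open>1 - cmod w\<close> and the distance of \<open>w\<close> and \<open>z k\<close>;
  the quotient \<open>\<delta> k / D k w\<close> bounds, up to a factor \<open>2\<close>, the deviation from \<open>1\<close> of the \<open>k\<close>-th Blaschke factor at \<open>w\<close>.
\<close>

definition D :: "nat \<Rightarrow> complex \<Rightarrow> real" where "D k w = cmod (1 - cnj (z k) * w)"

lemma delta_pos: "0 < \<delta> k" and delta_le_1: "\<delta> k \<le> 1"
  using in_disc[of k] by (auto simp: \<delta>_def)

text \<open>
  If the points are within \<open>d / 4\<close> of one of them, \<open>z k\<close>, each of the others contributes at least
  \<open>ln 2\<close> to the logarithmic sum centred at \<open>z k\<close>.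
\<close>

lemma cluster_card_le:
  assumes "finite J" "\<And>i. i \<in> J \<Longrightarrow> d \<le> \<delta> i" "0 < d"
    and close: "\<And>i j. i \<in> J \<Longrightarrow> j \<in> J \<Longrightarrow> cmod (z i - z j) \<le> d / 4"
  shows "real (card J) \<le> (1 + C / ln 2) * d powr (-\<rho>)"
proof (cases "J = {}")
  case False
  then obtain k where k: "k \<in> J" by blast
  have d: "d \<le> \<delta> k" using assms k by auto
  have "real (card (J - {k})) * ln 2 = (\<Sum>j\<in>J - {k}. ln 2)" by simp
  also have "\<dots> \<le> (\<Sum>j\<in>J - {k}. ln ((1 - cmod (z k)) / (2 * cmod (z j - z k))))"
  proof (intro sum_mono)
    fix j assume j: "j \<in> J - {k}"
    hence "z j \<noteq> z k" using inj by (auto dest: injD)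
    hence pos: "cmod (z j - z k) > 0" by simp
    have "2 \<le> \<delta> k / (2 * cmod (z j - z k))"
      using close[of j k] j k d pos by (simp add: field_simps)
    thus "ln 2 \<le> ln ((1 - cmod (z k)) / (2 * cmod (z j - z k)))"
      by (simp add: \<delta>_def)
  qed
  also have "\<dots> \<le> C * (1 - cmod (z k)) powr (-\<rho>)"
    using assms close[of _ k] k d
    by (intro log_sum_le) (fastforce simp: \<delta>_def)+
  also have "\<dots> \<le> C * d powr (-\<rho>)"
    using d C_pos rho \<open>0 < d\<close> by (intro mult_left_mono powr_mono2') (auto simp: \<delta>_def)
  finally have "real (card (J - {k})) \<le> C / ln 2 * d powr (-\<rho>)"
    by (simp add: field_simps)
  moreover have "1 \<le> d powr (-\<rho>)"
    using d delta_le_1[of k] rho \<open>0 < d\<close> by (intro powr_minus_ge_1) auto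
  moreover have "real (card J) = 1 + real (card (J - {k}))"
    using k \<open>finite J\<close> by (metis card.remove of_nat_Suc add.commute)
  ultimately show ?thesis by (simp add: ring_distribs)
qed (use C_pos in auto)

text \<open>
  Square cells of side \<open>d / 8\<close> have diameter below \<open>d / 4\<close>, so each holds a single cluster, and about
  \<open>(R / d)\<^sup>2\<close> cells cover the disc.  Counting cells in the plane, instead of Whitney boxes along the
  circle, is wasteful for large \<open>R\<close>; the loss is made up by the choice of the exponent \<open>m\<close> below.
\<close>

lemma disc_card_le:
  assumes "finite J" and J: "\<And>j. j \<in> J \<Longrightarrow> d \<le> \<delta> j" "\<And>j. j \<in> J \<Longrightarrow> cmod (z j - w) \<le> R"
    and "0 < d" "d \<le> R"
  shows "real (card J) \<le> 361 * (R / d)\<^sup>2 * ((1 + C / ln 2) * d powr (-\<rho>))"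
proof -
  define h where "h = d / 8"
  have h: "h > 0" using \<open>0 < d\<close> by (simp add: h_def)
  define cell where "cell j = (\<lfloor>Re (z j - w) / h\<rfloor>, \<lfloor>Im (z j - w) / h\<rfloor>)" for j
  define N where "N = \<lceil>R / h\<rceil>"
  have N: "real_of_int N \<ge> R / h" "real_of_int N < R / h + 1"
    unfolding N_def by linarith+
  have N0: "N \<ge> 0" proof -
    have "R / h > 0" using assms h by simp
    thus ?thesis unfolding N_def by linarith
  qed
  have "cell ` J \<subseteq> {-N..N} \<times> {-N..N}"
  proof (intro image_subsetI)
    have *: "\<lfloor>x / h\<rfloor> \<in> {-N..N}" if "\<bar>x\<bar> \<le> R" for x
    proof -
      have "\<bar>x / h\<bar> \<le> R / h" using that h by (simp add: divide_right_mono)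
      hence "- real_of_int N \<le> x / h" "x / h \<le> real_of_int N" using N by linarith+
      thus ?thesis by (simp add: le_floor_iff floor_le_iff)
    qed
    fix j assume "j \<in> J"
    hence "\<bar>Re (z j - w)\<bar> \<le> R" "\<bar>Im (z j - w)\<bar> \<le> R"
      using J(2) abs_Re_le_cmod abs_Im_le_cmod by (blast intro: order_trans)+
    thus "cell j \<in> {-N..N} \<times> {-N..N}"
      unfolding cell_def using * by blast
  qed
  hence "card (cell ` J) \<le> card ({-N..N} \<times> {-N..N})"
    by (intro card_mono) auto
  also have "\<dots> = (nat (2 * N + 1))\<^sup>2"
    by (simp add: card_cartesian_product power2_eq_square)
  finally have "real (card (cell ` J)) \<le> (real_of_int (2 * N + 1))\<^sup>2"
    using N0 by (metis of_nat_le_iff of_nat_power of_nat_nat add_nonneg_nonneg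
        mult_nonneg_nonneg zero_le_numeral zero_le_one)
  also have "\<dots> \<le> (19 * (R / d))\<^sup>2"
  proof (intro power_mono)
    have "1 \<le> R / d" using assms by simp
    thus "real_of_int (2 * N + 1) \<le> 19 * (R / d)"
      using N(2) by (simp add: h_def)
  qed (use N0 in auto)
  finally have card_cells: "real (card (cell ` J)) \<le> 361 * (R / d)\<^sup>2"
    by (simp add: power_mult_distrib power_divide)
  have fiber: "real (card {j\<in>J. cell j = c}) \<le> (1 + C / ln 2) * d powr (-\<rho>)" for c
  proof (rule cluster_card_le)
    fix i j assume ij: "i \<in> {j\<in>J. cell j = c}" "j \<in> {j\<in>J. cell j = c}"
    have *: "\<bar>x - y\<bar> \<le> h" if "\<lfloor>x / h\<rfloor> = \<lfloor>y / h\<rfloor>" for x y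
    proof -
      have "\<bar>x / h - y / h\<bar> \<le> 1" using that by linarith
      thus ?thesis using h by (simp add: diff_divide_distrib [symmetric] field_simps)
    qed
    have "\<bar>Re (z i - w) - Re (z j - w)\<bar> \<le> h" "\<bar>Im (z i - w) - Im (z j - w)\<bar> \<le> h"
      using ij by (intro *; auto simp: cell_def)+
    hence "cmod (z i - z j) \<le> h + h"
      using cmod_le[of "z i - z j"] by simp
    thus "cmod (z i - z j) \<le> d / 4" by (simp add: h_def)
  qed (use assms in auto)
  have "real (card J) = (\<Sum>c\<in>cell ` J. real (card {j\<in>J. cell j = c}))"
    using sum.image_gen[OF \<open>finite J\<close>, of "\<lambda>_. 1::nat" cell]
    by (simp flip: of_nat_sum)
  also have "\<dots> \<le> (\<Sum>c\<in>cell ` J. (1 + C / ln 2) * d powr (-\<rho>))"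
    by (intro sum_mono fiber)
  also have "\<dots> = real (card (cell ` J)) * ((1 + C / ln 2) * d powr (-\<rho>))"
    by simp
  also have "\<dots> \<le> 361 * (R / d)\<^sup>2 * ((1 + C / ln 2) * d powr (-\<rho>))"
    using card_cells C_pos by (intro mult_right_mono) auto
  finally show ?thesis .
qed

lemma dist_le_D:
  assumes "cmod w \<le> 1"
  shows "cmod (z k - w) \<le> D k w"
proof -
  have "(D k w)\<^sup>2 - (cmod (z k - w))\<^sup>2 = (1 - (cmod (z k))\<^sup>2) * (1 - (cmod w)\<^sup>2)"
    unfolding D_def cmod_power2 by (simp add: power2_eq_square algebra_simps)
  also have "\<dots> \<ge> 0"
    using power_le_one[of "cmod (z k)" 2] power_le_one[of "cmod w" 2] in_disc[of k] assms
    by (intro mult_nonneg_nonneg) simp_all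
  finally have "(cmod (z k - w))\<^sup>2 \<le> (D k w)\<^sup>2" by simp
  thus ?thesis by (rule power2_le_imp_le) (simp add: D_def)
qed

lemma D_ge:
  assumes "cmod w < 1"
  shows "\<delta> k \<le> D k w" "1 - cmod w \<le> D k w" "0 < D k w"
proof -
  have "1 - cmod (z k) * cmod w \<le> D k w"
    unfolding D_def using norm_triangle_ineq2[of 1 "cnj (z k) * w"] by (simp add: norm_mult)
  moreover have "cmod (z k) * cmod w \<le> cmod (z k)" "cmod (z k) * cmod w \<le> cmod w"
    using in_disc[of k] assms by (auto intro: mult_left_le mult_left_le_one_le)
  ultimately show "\<delta> k \<le> D k w" "1 - cmod w \<le> D k w"
    by (auto simp: \<delta>_def)
  thus "0 < D k w" using assms by linarith
qed

lemma D_le: "cmod w \<le> 1 \<Longrightarrow> D k w \<le> 2 * (1 - cmod w) + cmod (z k - w)"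
proof -
  assume w: "cmod w \<le> 1"
  \<comment> \<open>The value for \<open>z k = w\<close> plus a multiple of the distance.\<close>
  have "1 - cnj (z k) * w = of_real (1 - (cmod w)\<^sup>2) - cnj (z k - w) * w"
    by (simp add: complex_norm_square algebra_simps del: of_real_power)
  hence "D k w \<le> \<bar>1 - (cmod w)\<^sup>2\<bar> + cmod (z k - w) * cmod w"
    unfolding D_def
    by (metis norm_triangle_ineq4 norm_of_real norm_mult complex_mod_cnj)
  also have "\<dots> \<le> (1 - cmod w) * 2 + cmod (z k - w) * 1"
  proof (intro add_mono mult_left_mono)
    have "1 - (cmod w)\<^sup>2 = (1 - cmod w) * (1 + cmod w)"
      by (simp add: algebra_simps power2_eq_square)
    also have "\<dots> \<le> (1 - cmod w) * 2" using w by (intro mult_left_mono) auto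
    finally show "\<bar>1 - (cmod w)\<^sup>2\<bar> \<le> (1 - cmod w) * 2"
      using w by (simp add: power_le_one)
  qed (use w in auto)
  finally show ?thesis by simp
qed

text \<open>
  By \<open>disc_card_le\<close>, for a fixed dyadic size of \<open>D j w\<close> the bound on the number of points with
  \<open>D j w / \<delta> j\<close> about \<open>2 ^ l\<close> grows with \<open>l\<close> like \<open>2 powr (l * (2 + \<rho>))\<close>; an exponent of at least
  \<open>\<rho> + 3\<close> therefore makes the sum over \<open>l\<close> geometric.
\<close>

definition m :: nat where "m = nat \<lceil>\<rho>\<rceil> + 3"

lemma m_ge: "real m \<ge> \<rho> + 3"
  unfolding m_def by linarith

text \<open>
  The points are sorted by the dyadic sizes \<open>i\<close> of \<open>D j w / s\<close>, with \<open>s = 1 - cmod w\<close>, and \<open>l\<close> of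
  \<open>D j w / \<delta> j\<close>, both of which are at least \<open>1\<close>.  In a class \<open>(i, l)\<close> all points have
  \<open>\<delta> j \<ge> 2 ^ i * s / 2 ^ Suc l\<close> and lie within \<open>2 ^ Suc i * s\<close> of \<open>w\<close>, so they can be counted;
  multiplied by the size of the terms the count decays geometrically in \<open>i\<close>, owing to the negative
  power \<open>-\<rho>\<close>, and in \<open>l\<close>, owing to the size of \<open>m\<close>.
\<close>

lemma kernel_sum_bound:
  obtains K where "K > 0"
    "\<And>J w. finite J \<Longrightarrow> cmod w < 1 \<Longrightarrow> (\<Sum>j\<in>J. (\<delta> j / D j w) ^ m) \<le> K * (1 - cmod w) powr (-\<rho>)"
proof -
  define q where "q = 2 powr (-\<rho>)"
  have q: "0 < q" "q < 1" using rho by (auto simp: q_def powr_less_one)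
  define B where "B = 361 * 16 * ((1 + C / ln 2) * 2 powr \<rho>)"
  have B: "B > 0" using C_pos by (auto simp: B_def intro!: add_pos_pos mult_pos_pos)
  show ?thesis
  proof (rule that[of "B * (1 / (1 - q) * 2)"])
    show "B * (1 / (1 - q) * 2) > 0" using q B by simp
    fix J :: "nat set" and w :: complex assume J: "finite J" and w: "cmod w < 1"
    define s where "s = 1 - cmod w"
    have s: "s > 0" using w by (simp add: s_def)
    note D = D_ge[OF w, folded s_def]
    have "\<exists>il. 2 ^ fst il \<le> D j w / s \<and> D j w / s < 2 ^ Suc (fst il) \<and>
               2 ^ snd il \<le> D j w / \<delta> j \<and> D j w / \<delta> j < 2 ^ Suc (snd il)" for j
    proof -
      have "D j w / s \<ge> 1" "D j w / \<delta> j \<ge> 1" using D s delta_pos by auto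
      thus ?thesis by (metis dyadic_index fst_conv snd_conv)
    qed
    then obtain idx :: "nat \<Rightarrow> nat \<times> nat" where idx:
      "\<And>j. 2 ^ fst (idx j) \<le> D j w / s" "\<And>j. D j w / s < 2 ^ Suc (fst (idx j))"
      "\<And>j. 2 ^ snd (idx j) \<le> D j w / \<delta> j" "\<And>j. D j w / \<delta> j < 2 ^ Suc (snd (idx j))"
      by metis
    have fiber: "(\<Sum>j\<in>{j\<in>J. idx j = (i, l)}. (\<delta> j / D j w) ^ m) \<le> B * s powr (-\<rho>) * (q ^ i * (1/2) ^ l)"
      for i l :: nat
    proof -
      let ?F = "{j\<in>J. idx j = (i, l)}"
      define d where "d = 2 ^ i * s / 2 ^ Suc l"
      define R where "R = 2 ^ Suc i * s"
      have "d > 0" using s by (simp add: d_def)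
      have j: "d \<le> \<delta> j" "D j w \<le> R" "(\<delta> j / D j w) ^ m \<le> (1 / 2 ^ l) ^ m" if "j \<in> ?F" for j
      proof -
        have e: "2 ^ i * s \<le> D j w" "D j w < 2 ^ Suc i * s" "2 ^ l * \<delta> j \<le> D j w" "D j w < 2 ^ Suc l * \<delta> j"
          using idx[of j] that s delta_pos[of j] by (auto simp: field_simps)
        show "D j w \<le> R" using e by (simp add: R_def)
        have "2 ^ i * s < 2 ^ Suc l * \<delta> j" using e by linarith
        thus "d \<le> \<delta> j" by (simp add: d_def field_simps)
        show "(\<delta> j / D j w) ^ m \<le> (1 / 2 ^ l) ^ m"
          using e D(3)[of j] delta_pos[of j] by (intro power_mono) (auto simp: field_simps)
      qed
      have "real (card ?F) \<le> 361 * (R / d)\<^sup>2 * ((1 + C / ln 2) * d powr (-\<rho>))"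
      proof (rule disc_card_le)
        show "cmod (z j - w) \<le> R" if "j \<in> ?F" for j
          using j(2)[OF that] dist_le_D[of w j] w by linarith
        have "2 ^ i * s / 2 ^ Suc l \<le> 2 ^ i * s / 1"
          using s by (intro divide_left_mono) (auto intro: one_le_power simp del: power_Suc)
        also have "\<dots> \<le> R" using s by (simp add: R_def)
        finally show "d \<le> R" by (simp add: d_def)
      qed (use J j \<open>d > 0\<close> in auto)
      also have "R / d = 4 * 2 ^ l" using s by (simp add: R_def d_def)
      also have "d powr (-\<rho>) = q ^ i * s powr (-\<rho>) * 2 powr \<rho> * (2 powr \<rho>) ^ l"
      proof -
        have "d = 2 ^ i * s * ((1/2) * (1/2) ^ l)"
          by (simp add: d_def power_divide)
        also have "\<dots> powr (-\<rho>) = q ^ i * s powr (-\<rho>) * ((1/2) powr (-\<rho>) * ((1/2) powr (-\<rho>)) ^ l)"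
          unfolding powr_mult q_def by (simp add: power_powr_commute)
        also have "(1/2) powr (-\<rho>) = 2 powr \<rho>"
          by (simp add: powr_divide powr_minus)
        finally show ?thesis by (simp add: mult_ac)
      qed
      also have "(4 * 2 ^ l :: real)\<^sup>2 = 16 * 4 ^ l"
      proof -
        have "(2 ^ l :: real) * 2 ^ l = 4 ^ l" by (simp flip: power_mult_distrib)
        thus ?thesis by (simp add: power2_eq_square)
      qed
      finally have card: "real (card ?F) \<le> B * s powr (-\<rho>) * (q ^ i * (4 * 2 powr \<rho>) ^ l)"
        by (simp add: B_def power_mult_distrib mult_ac)
      have "(\<Sum>j\<in>?F. (\<delta> j / D j w) ^ m) \<le> real (card ?F) * (1 / 2 ^ l) ^ m"
        using sum_bounded_above[of ?F "\<lambda>j. (\<delta> j / D j w) ^ m" "(1 / 2 ^ l) ^ m"] j(3) by simp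
      also have "\<dots> \<le> B * s powr (-\<rho>) * (q ^ i * (4 * 2 powr \<rho>) ^ l) * (1 / 2 ^ l) ^ m"
        by (intro mult_right_mono card) auto
      also have "\<dots> = B * s powr (-\<rho>) * (q ^ i * (4 * 2 powr \<rho> / 2 ^ m) ^ l)"
      proof -
        have "(1 / 2 ^ l :: real) ^ m = (1 / 2 ^ m) ^ l"
          by (simp add: power_divide mult.commute flip: power_mult)
        thus ?thesis by (simp only: times_divide_eq_right mult_1_right power_divide) simp
      qed
      also have "\<dots> \<le> B * s powr (-\<rho>) * (q ^ i * (1/2) ^ l)"
      proof (intro mult_left_mono power_mono)
        have "4 * 2 powr \<rho> * 2 = 2 powr (\<rho> + 3)" by (simp add: powr_add)
        also have "\<dots> \<le> 2 powr real m" using m_ge by (intro powr_mono) auto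
        also have "\<dots> = 2 ^ m" by (simp add: powr_realpow)
        finally show "4 * 2 powr \<rho> / 2 ^ m \<le> (1/2 :: real)" by (simp add: field_simps)
      qed (use q B in auto)
      finally show ?thesis .
    qed
    define N where "N = Suc (Max (insert 0 (fst ` idx ` J \<union> snd ` idx ` J)))"
    have "x < N" if "x \<in> fst ` idx ` J \<union> snd ` idx ` J" for x
      unfolding N_def using J that by (intro le_imp_less_Suc Max_ge) auto
    hence sub: "idx ` J \<subseteq> {..<N} \<times> {..<N}"
      by (intro image_subsetI) (simp add: mem_Times_iff)
    have geo: "(\<Sum>i<N. x ^ i) \<le> 1 / (1 - x)" if "0 \<le> x" "x < 1" for x :: real
      using that by (simp add: sum_gp_strict divide_right_mono)
    have "(\<Sum>j\<in>J. (\<delta> j / D j w) ^ m) = (\<Sum>c\<in>idx ` J. \<Sum>j\<in>{j\<in>J. idx j = c}. (\<delta> j / D j w) ^ m)"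
      using sum.image_gen[OF J] .
    also have "\<dots> \<le> (\<Sum>c\<in>idx ` J. B * s powr (-\<rho>) * (q ^ fst c * (1/2) ^ snd c))"
      using fiber[of "fst c" "snd c" for c] by (intro sum_mono) simp
    also have "\<dots> \<le> (\<Sum>c\<in>{..<N} \<times> {..<N}. B * s powr (-\<rho>) * (q ^ fst c * (1/2) ^ snd c))"
      using sub B q by (intro sum_mono2) auto
    also have "\<dots> = B * s powr (-\<rho>) * (\<Sum>c\<in>{..<N} \<times> {..<N}. q ^ fst c * (1/2) ^ snd c)"
      by (simp only: sum_distrib_left)
    also have "(\<Sum>c\<in>{..<N} \<times> {..<N}. q ^ fst c * (1/2) ^ snd c) = (\<Sum>i<N. q ^ i) * (\<Sum>l<N. (1/2) ^ l)"
      by (simp only: sum_product sum.cartesian_product case_prod_unfold)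
    also have "B * s powr (-\<rho>) * \<dots> \<le> B * s powr (-\<rho>) * (1 / (1 - q) * 2)"
    proof (intro mult_left_mono mult_mono)
      show "(\<Sum>i<N. q ^ i) \<le> 1 / (1 - q)" using geo[of q] q by simp
      show "(\<Sum>l<N. (1/2) ^ l) \<le> (2 :: real)" using geo[of "1/2"] by simp
    qed (use q B in \<open>auto intro!: sum_nonneg\<close>)
    finally show "(\<Sum>j\<in>J. (\<delta> j / D j w) ^ m) \<le> B * (1 / (1 - q) * 2) * (1 - cmod w) powr (-\<rho>)"
      by (simp add: s_def mult_ac)
  qed
qed

end

section \<open>Weierstrass factors built from Blaschke factors\<close>

lemma exp_minus_twice_le:
  fixes x :: real
  assumes "0 \<le> x" "x \<le> 1/2"
  shows "exp (-(2 * x)) \<le> 1 - x"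
proof -
  have "x * x \<le> 1/2 * x" using assms by (intro mult_right_mono) auto
  hence "1 \<le> (1 - x) * (1 + 2 * x)" by (simp add: algebra_simps)
  also have "\<dots> \<le> (1 - x) * exp (2 * x)"
    using assms exp_ge_add_one_self[of "2 * x"] by (intro mult_left_mono) auto
  finally show ?thesis by (simp add: exp_minus field_simps)
qed

text \<open>
  The first estimate is the classical one near \<open>0\<close>, extended to a compact set.  Below, the factor is
  compared with \<open>1 - A\<close>, which carries its zero; when that is not small the zero is too far away to
  matter and the factor is bounded below by the exponential alone.  The threshold \<open>1 / 9\<close> is the one
  that \<open>D_le\<close> provides for points at distance at least \<open>(1 - cmod w) / 4\<close>.
\<close>

lemma weierstrass_factor_estimates:
  obtains K where "K > 0"
    "\<And>A. cmod (1 - A) \<le> 1 \<Longrightarrow> cmod (weierstrass_factor p A - 1) \<le> K * cmod A ^ Suc p"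
    "\<And>A. cmod (1 - A) \<le> 1 \<Longrightarrow> cmod (1 - A) * exp (- K * cmod A ^ Suc p) \<le> cmod (weierstrass_factor p A)"
    "\<And>A. \<lbrakk>cmod (1 - A) \<le> 1; 1 / 9 \<le> cmod (1 - A)\<rbrakk> \<Longrightarrow> exp (- K * cmod A ^ Suc p) \<le> cmod (weierstrass_factor p A)"
proof -
  let ?S = "\<lambda>A::complex. \<Sum>k=1..p. A ^ k / of_nat k"
  have bounded_on_cball: "\<exists>B>0. \<forall>A. cmod A \<le> 2 \<longrightarrow> cmod (f A) \<le> B"
    if "continuous_on (cball 0 2) f" for f :: "complex \<Rightarrow> complex"
  proof -
    have "bounded (f ` cball 0 2)"
      using that by (intro compact_imp_bounded compact_continuous_image) auto
    thus ?thesis unfolding bounded_pos by (auto simp: image_iff)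
  qed
  have factor_cont: "continuous_on (cball 0 2) (\<lambda>A. weierstrass_factor p A - 1)"
    by (intro continuous_intros)
  obtain B1 where B1: "B1 > 0" "\<And>A. cmod A \<le> 2 \<Longrightarrow> cmod (weierstrass_factor p A - 1) \<le> B1"
    using bounded_on_cball[OF factor_cont] by blast
  have "continuous_on (cball 0 2) ?S" by (intro continuous_intros) auto
  then obtain B2 where B2: "B2 > 0" "\<And>A. cmod A \<le> 2 \<Longrightarrow> cmod (?S A) \<le> B2"
    using bounded_on_cball by blast
  define K where "K = 6 + B1 * 2 ^ Suc p + (B2 + ln 9) * 8 ^ Suc p"
  have parts: "B1 * 2 ^ Suc p \<ge> 0" "(B2 + ln 9) * 8 ^ Suc p \<ge> 0" using B1 B2 by simp_all
  have K: "6 \<le> K" "B1 * 2 ^ Suc p \<le> K" "(B2 + ln 9) * 8 ^ Suc p \<le> K"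
    using parts unfolding K_def by linarith+
  have le2: "cmod A \<le> 2" if "cmod (1 - A) \<le> 1" for A
    using that norm_triangle_ineq4[of 1 "1 - A"] by simp
  \<comment> \<open>A constant is a multiple of \<open>cmod A ^ Suc p\<close> as soon as \<open>A\<close> is bounded away from \<open>0\<close>.\<close>
  have large: "b \<le> K * cmod A ^ Suc p" if "c > 0" "c \<le> cmod A" "b * (1 / c) ^ Suc p \<le> K" for b c :: real and A :: complex
  proof -
    have "b = b * (1 / c) ^ Suc p * c ^ Suc p"
      using that by (simp add: power_divide)
    also have "\<dots> \<le> K * c ^ Suc p" using that by (intro mult_right_mono) auto
    also have "\<dots> \<le> K * cmod A ^ Suc p"
      using that K(1) by (intro mult_left_mono power_mono) auto
    finally show ?thesis .
  qed
  have exp_ge: "exp (- B2) \<le> cmod (exp (?S A))" if "cmod A \<le> 2" for A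
    using B2(2)[OF that] abs_Re_le_cmod[of "?S A"] by (simp add: abs_le_iff)
  have small: "exp (- K * cmod A ^ Suc p) \<le> cmod (weierstrass_factor p A)" if "cmod A \<le> 1 / 8" for A
  proof -
    have "cmod A ^ Suc p \<le> cmod A"
      using that power_decreasing[of 1 "Suc p" "cmod A"] by simp
    hence x: "0 \<le> 3 * cmod A ^ Suc p" "3 * cmod A ^ Suc p \<le> 1/2" using that by auto
    have "exp (- K * cmod A ^ Suc p) \<le> exp (-(2 * (3 * cmod A ^ Suc p)))"
      using mult_right_mono[OF K(1), of "cmod A ^ Suc p"] by simp
    also have "\<dots> \<le> 1 - 3 * cmod A ^ Suc p" by (rule exp_minus_twice_le[OF x])
    also have "\<dots> \<le> 1 - cmod (weierstrass_factor p A - 1)"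
      using weierstrass_factor_bound[of A p] that by simp
    also have "\<dots> \<le> cmod (weierstrass_factor p A)"
      using norm_triangle_ineq2[of 1 "1 - weierstrass_factor p A"] by (simp add: norm_minus_commute)
    finally show ?thesis .
  qed
  show ?thesis
  proof (rule that[of K])
    fix A assume A: "cmod (1 - A) \<le> 1"
    note A2 = le2[OF A]
    show "cmod (weierstrass_factor p A - 1) \<le> K * cmod A ^ Suc p"
    proof (cases "cmod A \<le> 1 / 2")
      case True
      have "cmod (weierstrass_factor p A - 1) \<le> 3 * cmod A ^ Suc p"
        using weierstrass_factor_bound[OF True] .
      also have "\<dots> \<le> K * cmod A ^ Suc p"
        using K by (intro mult_right_mono) auto
      finally show ?thesis .
    next
      case False
      thus ?thesis
        using B1(2)[OF A2] large[of "1/2" A B1] K(2) by simp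
    qed
    show "cmod (1 - A) * exp (- K * cmod A ^ Suc p) \<le> cmod (weierstrass_factor p A)"
    proof (cases "cmod A \<le> 1 / 8")
      case True
      have "cmod (1 - A) * exp (- K * cmod A ^ Suc p) \<le> 1 * exp (- K * cmod A ^ Suc p)"
        by (intro mult_right_mono A) auto
      thus ?thesis using small[OF True] by linarith
    next
      case False
      have "B2 * 8 ^ Suc p \<le> K"
        by (rule order_trans[OF _ K(3)], rule mult_right_mono) auto
      hence "B2 \<le> K * cmod A ^ Suc p"
        using False by (intro large[of "1/8"]) auto
      hence "exp (- K * cmod A ^ Suc p) \<le> exp (- B2)" by simp
      also have "\<dots> \<le> cmod (exp (?S A))" by (rule exp_ge[OF A2])
      finally show ?thesis
        unfolding weierstrass_factor_def norm_mult by (intro mult_left_mono) auto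
    qed
    assume A9: "1 / 9 \<le> cmod (1 - A)"
    show "exp (- K * cmod A ^ Suc p) \<le> cmod (weierstrass_factor p A)"
    proof (cases "cmod A \<le> 1 / 8")
      case False
      have "B2 + ln 9 \<le> K * cmod A ^ Suc p"
        using False K(3) by (intro large[of "1/8"]) auto
      hence "exp (- K * cmod A ^ Suc p) \<le> exp (- ln 9 - B2)" by simp
      also have "\<dots> = 1 / 9 * exp (- B2)" by (simp add: exp_diff exp_minus field_simps)
      also have "\<dots> \<le> cmod (1 - A) * cmod (exp (?S A))"
        by (intro mult_mono A9 exp_ge[OF A2]) auto
      finally show ?thesis by (simp add: weierstrass_factor_def norm_mult)
    qed (rule small)
  qed (use K in auto)
qed

context sparse_sequence
begin

text \<open>
  The rotation \<open>u k\<close> turns \<open>1 - A k w\<close> into a unimodular multiple of the Blaschke factor of \<open>z k\<close> and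
  keeps \<open>A k w\<close> small, for fixed \<open>w\<close>, when \<open>z k\<close> is near the circle.  Any unimodular value serves for a zero at the
  origin.
\<close>

definition u :: "nat \<Rightarrow> complex" where "u k = (if z k = 0 then 1 else sgn (z k))"

definition A :: "nat \<Rightarrow> complex \<Rightarrow> complex" where
  "A k w = of_real (\<delta> k) * (1 + cnj (u k) * w) / (1 - cnj (z k) * w)"

lemma norm_u [simp]: "cmod (u k) = 1"
  by (simp add: u_def norm_sgn)

lemma z_polar: "z k = of_real (cmod (z k)) * u k"
  by (auto simp: u_def sgn_eq)

lemma denominator_nonzero: "cmod w < 1 \<Longrightarrow> 1 - cnj (z k) * w \<noteq> 0"
  using D_ge(3)[of w k] by (auto simp: D_def)

lemma one_minus_A:
  assumes "cmod w < 1"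
  shows "1 - A k w = cnj (u k) * (z k - w) / (1 - cnj (z k) * w)"
proof -
  define r where "r = complex_of_real (cmod (z k))"
  have z: "z k = r * u k" unfolding r_def by (rule z_polar)
  have r: "cnj r = r" by (simp add: r_def)
  have u: "cnj (u k) * u k = 1"
    by (metis complex_norm_square mult.commute norm_u of_real_1 one_power2)
  have nr: "complex_of_real (\<delta> k) = 1 - r" by (simp add: \<delta>_def r_def)
  have nz: "1 - cnj (z k) * w \<noteq> 0" using denominator_nonzero[OF assms] .
  have "1 - A k w = ((1 - r * cnj (u k) * w) - (1 - r) * (1 + cnj (u k) * w)) / (1 - cnj (z k) * w)"
    using nz unfolding A_def nr by (simp add: z r diff_divide_distrib)
  also have "(1 - r * cnj (u k) * w) - (1 - r) * (1 + cnj (u k) * w) = cnj (u k) * u k * r - cnj (u k) * w"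
    by (simp add: u) (simp add: algebra_simps)
  also have "\<dots> = cnj (u k) * (z k - w)" by (simp add: z algebra_simps)
  finally show ?thesis .
qed

lemma norm_one_minus_A:
  assumes "cmod w < 1"
  shows "cmod (1 - A k w) = cmod (z k - w) / D k w" "cmod (1 - A k w) \<le> 1"
proof -
  show 1: "cmod (1 - A k w) = cmod (z k - w) / D k w"
    by (simp add: one_minus_A[OF assms] norm_mult norm_divide D_def)
  show "cmod (1 - A k w) \<le> 1"
    unfolding 1 using dist_le_D[of w k] D_ge(3)[OF assms] assms by simp
qed

lemma norm_A_le:
  assumes "cmod w < 1"
  shows "cmod (A k w) \<le> 2 * (\<delta> k / D k w)"
proof -
  have "cmod (1 + cnj (u k) * w) \<le> 2"
    using norm_triangle_ineq[of 1 "cnj (u k) * w"] assms by (simp add: norm_mult)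
  hence "\<delta> k * cmod (1 + cnj (u k) * w) / D k w \<le> \<delta> k * 2 / D k w"
    using delta_pos[of k] by (intro divide_right_mono mult_left_mono) (auto simp: D_def)
  thus ?thesis using delta_pos[of k] by (simp add: A_def norm_mult norm_divide D_def mult.commute)
qed

lemma A_holomorphic [holomorphic_intros]: "A k holomorphic_on ball 0 1"
  unfolding A_def using denominator_nonzero by (intro holomorphic_intros) auto

definition E :: "nat \<Rightarrow> complex \<Rightarrow> complex" where
  "E k w = weierstrass_factor (m - 1) (A k w)"

lemma Suc_genus: "Suc (m - 1) = m"
  by (simp add: m_def)

lemma E_holomorphic [holomorphic_intros]: "E k holomorphic_on ball 0 1"
  unfolding E_def by (intro holomorphic_intros)

lemma E_estimates:
  obtains K where "K > 0"
    "\<And>k w. cmod w < 1 \<Longrightarrow> cmod (E k w - 1) \<le> K * (\<delta> k / D k w) ^ m"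
    "\<And>k w. cmod w < 1 \<Longrightarrow> cmod (z k - w) / D k w * exp (- K * (\<delta> k / D k w) ^ m) \<le> cmod (E k w)"
    "\<And>k w. \<lbrakk>cmod w < 1; (1 - cmod w) / 4 \<le> cmod (z k - w)\<rbrakk> \<Longrightarrow>
       exp (- K * (\<delta> k / D k w) ^ m) \<le> cmod (E k w)"
proof -
  obtain K where K: "K > 0"
    "\<And>A. cmod (1 - A) \<le> 1 \<Longrightarrow> cmod (weierstrass_factor (m - 1) A - 1) \<le> K * cmod A ^ m"
    "\<And>A. cmod (1 - A) \<le> 1 \<Longrightarrow> cmod (1 - A) * exp (- K * cmod A ^ m) \<le> cmod (weierstrass_factor (m - 1) A)"
    "\<And>A. \<lbrakk>cmod (1 - A) \<le> 1; 1 / 9 \<le> cmod (1 - A)\<rbrakk> \<Longrightarrow> exp (- K * cmod A ^ m) \<le> cmod (weierstrass_factor (m - 1) A)"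
    using weierstrass_factor_estimates[of "m - 1"] unfolding Suc_genus by blast
  have pow: "K * cmod (A k w) ^ m \<le> K * 2 ^ m * (\<delta> k / D k w) ^ m" if "cmod w < 1" for k w
    using mult_left_mono[OF power_mono[OF norm_A_le[OF that, of k], of m], of K] K(1)
    unfolding power_mult_distrib by (simp add: mult.assoc)
  have exp_pow: "exp (- (K * 2 ^ m) * (\<delta> k / D k w) ^ m) \<le> exp (- K * cmod (A k w) ^ m)" if "cmod w < 1" for k w
    using pow[OF that, of k] by simp
  show ?thesis
  proof (rule that[of "K * 2 ^ m"])
    fix k w assume w: "cmod w < 1"
    note A = norm_one_minus_A[OF w, of k]
    show "cmod (E k w - 1) \<le> K * 2 ^ m * (\<delta> k / D k w) ^ m"
      unfolding E_def using K(2)[OF A(2)] pow[OF w, of k] by linarith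
    have "cmod (1 - A k w) * exp (- (K * 2 ^ m) * (\<delta> k / D k w) ^ m) \<le> cmod (1 - A k w) * exp (- K * cmod (A k w) ^ m)"
      by (intro mult_left_mono exp_pow w) auto
    also have "\<dots> \<le> cmod (E k w)" unfolding E_def by (rule K(3)[OF A(2)])
    finally show "cmod (z k - w) / D k w * exp (- (K * 2 ^ m) * (\<delta> k / D k w) ^ m) \<le> cmod (E k w)"
      unfolding A(1) .
    assume far: "(1 - cmod w) / 4 \<le> cmod (z k - w)"
    hence "D k w \<le> 9 * cmod (z k - w)" using D_le[of w k] w by simp
    hence "1 / 9 \<le> cmod (1 - A k w)"
      unfolding A(1) using D_ge(3)[OF w, of k] by (simp add: field_simps)
    thus "exp (- (K * 2 ^ m) * (\<delta> k / D k w) ^ m) \<le> cmod (E k w)"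
      using K(4)[OF A(2)] exp_pow[OF w, of k] unfolding E_def by linarith
  qed (use K in auto)
qed

text \<open>
  The bounds for single factors, multiplied; the exponents add up to the sum of \<open>kernel_sum_bound\<close>.
  In the lower bound \<open>N\<close> must contain the indices of all zeros close to \<open>w\<close>, whose factors can be
  small; it may contain more.
\<close>

lemma finite_product_estimates:
  obtains K where "K > 0"
    "\<And>I w. \<lbrakk>finite I; cmod w < 1\<rbrakk> \<Longrightarrow> cmod (\<Prod>j\<in>I. E j w) \<le> exp (K * (1 - cmod w) powr (-\<rho>))"
    "\<And>I N w. \<lbrakk>finite I; cmod w < 1; N \<subseteq> I; \<And>j. j \<in> I - N \<Longrightarrow> (1 - cmod w) / 4 \<le> cmod (z j - w)\<rbrakk> \<Longrightarrow>
       (\<Prod>j\<in>N. cmod (z j - w) / D j w) * exp (- K * (1 - cmod w) powr (-\<rho>)) \<le> cmod (\<Prod>j\<in>I. E j w)"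
proof -
  obtain K where K: "K > 0"
    "\<And>k w. cmod w < 1 \<Longrightarrow> cmod (E k w - 1) \<le> K * (\<delta> k / D k w) ^ m"
    "\<And>k w. cmod w < 1 \<Longrightarrow> cmod (z k - w) / D k w * exp (- K * (\<delta> k / D k w) ^ m) \<le> cmod (E k w)"
    "\<And>k w. \<lbrakk>cmod w < 1; (1 - cmod w) / 4 \<le> cmod (z k - w)\<rbrakk> \<Longrightarrow>
       exp (- K * (\<delta> k / D k w) ^ m) \<le> cmod (E k w)"
    using E_estimates by metis
  obtain L where L: "L > 0"
    "\<And>J w. finite J \<Longrightarrow> cmod w < 1 \<Longrightarrow> (\<Sum>j\<in>J. (\<delta> j / D j w) ^ m) \<le> L * (1 - cmod w) powr (-\<rho>)"
    using kernel_sum_bound by metis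
  have S: "K * (\<Sum>j\<in>I. (\<delta> j / D j w) ^ m) \<le> K * L * (1 - cmod w) powr (-\<rho>)"
    if "finite I" "cmod w < 1" for I w
    using mult_left_mono[OF L(2)[OF that], of K] K(1) by simp
  show ?thesis
  proof (rule that[of "K * L"])
    show "K * L > 0" using K L by simp
    fix I N :: "nat set" and w :: complex assume I: "finite I" and w: "cmod w < 1"
    have "cmod (\<Prod>j\<in>I. E j w) \<le> (\<Prod>j\<in>I. exp (K * (\<delta> j / D j w) ^ m))"
      unfolding prod_norm [symmetric]
    proof (intro prod_mono conjI)
      fix j
      have "cmod (E j w) \<le> 1 + cmod (E j w - 1)"
        using norm_triangle_ineq[of 1 "E j w - 1"] by simp
      also have "\<dots> \<le> 1 + K * (\<delta> j / D j w) ^ m" using K(2)[OF w] by simp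
      also have "\<dots> \<le> exp (K * (\<delta> j / D j w) ^ m)" by (rule exp_ge_add_one_self)
      finally show "cmod (E j w) \<le> exp (K * (\<delta> j / D j w) ^ m)" .
    qed auto
    also have "\<dots> = exp (K * (\<Sum>j\<in>I. (\<delta> j / D j w) ^ m))"
      using I by (simp add: exp_sum sum_distrib_left)
    also have "\<dots> \<le> exp (K * L * (1 - cmod w) powr (-\<rho>))" using S[OF I w] by simp
    finally show "cmod (\<Prod>j\<in>I. E j w) \<le> exp (K * L * (1 - cmod w) powr (-\<rho>))" .
    assume N: "N \<subseteq> I" and far: "\<And>j. j \<in> I - N \<Longrightarrow> (1 - cmod w) / 4 \<le> cmod (z j - w)"
    let ?b = "\<lambda>j. if j \<in> N then cmod (z j - w) / D j w else 1"
    have "exp (- (K * L) * (1 - cmod w) powr (-\<rho>)) \<le> exp (- K * (\<Sum>j\<in>I. (\<delta> j / D j w) ^ m))"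
      using S[OF I w] by simp
    also have "\<dots> = (\<Prod>j\<in>I. exp (- K * (\<delta> j / D j w) ^ m))"
      unfolding sum_distrib_left by (rule exp_sum[OF I])
    finally have exp_le: "exp (- (K * L) * (1 - cmod w) powr (-\<rho>)) \<le> (\<Prod>j\<in>I. exp (- K * (\<delta> j / D j w) ^ m))" .
    have "(\<Prod>j\<in>N. cmod (z j - w) / D j w) = (\<Prod>j\<in>I. ?b j)"
      using N I prod.inter_restrict[of I "\<lambda>j. cmod (z j - w) / D j w" N] by (simp add: Int_absorb1)
    moreover have "(\<Prod>j\<in>I. ?b j) \<ge> 0"
      by (intro prod_nonneg) (auto simp: D_def)
    ultimately have "(\<Prod>j\<in>N. cmod (z j - w) / D j w) * exp (- (K * L) * (1 - cmod w) powr (-\<rho>))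
        \<le> (\<Prod>j\<in>I. ?b j) * (\<Prod>j\<in>I. exp (- K * (\<delta> j / D j w) ^ m))"
      by (simp only: mult_left_mono[OF exp_le])
    also have "\<dots> = (\<Prod>j\<in>I. ?b j * exp (- K * (\<delta> j / D j w) ^ m))"
      by (simp add: prod.distrib)
    also have "\<dots> \<le> (\<Prod>j\<in>I. cmod (E j w))"
      using K(3,4)[OF w] far by (intro prod_mono) (auto simp: D_def)
    also have "\<dots> = cmod (\<Prod>j\<in>I. E j w)" by (rule prod_norm)
    finally show "(\<Prod>j\<in>N. cmod (z j - w) / D j w) * exp (- (K * L) * (1 - cmod w) powr (-\<rho>))
        \<le> cmod (\<Prod>j\<in>I. E j w)" .
  qed
qed

end

section \<open>The canonical product\<close>

context sparse_sequence
begin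

lemma summable_delta: "summable (\<lambda>k. \<delta> k ^ m)"
proof -
  obtain L where L: "\<And>J w. finite J \<Longrightarrow> cmod w < 1 \<Longrightarrow> (\<Sum>j\<in>J. (\<delta> j / D j w) ^ m) \<le> L * (1 - cmod w) powr (-\<rho>)"
    using kernel_sum_bound by metis
  show ?thesis
  proof (rule summableI_nonneg_bounded)
    show "(\<Sum>k<n. \<delta> k ^ m) \<le> L" for n
      using L[of "{..<n}" 0] by (simp add: D_def)
  qed (use delta_pos in \<open>auto intro: less_imp_le\<close>)
qed

lemma finite_delta_ge:
  assumes "\<epsilon> > 0"
  shows "finite {k. \<epsilon> \<le> \<delta> k}"
proof -
  have "(\<lambda>k. \<delta> k ^ m) \<longlonglongrightarrow> 0" using summable_delta by (rule summable_LIMSEQ_zero)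
  hence "eventually (\<lambda>k. \<delta> k ^ m < \<epsilon> ^ m) sequentially"
    using assms by (intro order_tendstoD) auto
  then obtain k0 where k0: "\<And>k. k \<ge> k0 \<Longrightarrow> \<delta> k ^ m < \<epsilon> ^ m"
    by (auto simp: eventually_sequentially)
  have "{k. \<epsilon> \<le> \<delta> k} \<subseteq> {..<k0}"
  proof
    fix k assume "k \<in> {k. \<epsilon> \<le> \<delta> k}"
    hence "\<epsilon> ^ m \<le> \<delta> k ^ m" using assms by (intro power_mono) auto
    thus "k \<in> {..<k0}" using k0[of k] by (cases "k < k0") auto
  qed
  thus ?thesis using finite_subset by blast
qed

lemma delta_ge_near: "cmod (z j - w) \<le> R \<Longrightarrow> 1 - cmod w - R \<le> \<delta> j"
  using norm_triangle_ineq2[of "z j" w] by (simp add: \<delta>_def)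

lemma finite_near:
  assumes "R < 1 - cmod w"
  shows "finite {k. cmod (z k - w) \<le> R}"
proof (rule finite_subset)
  show "{k. cmod (z k - w) \<le> R} \<subseteq> {k. 1 - cmod w - R \<le> \<delta> k}"
    using delta_ge_near by blast
  show "finite {k. 1 - cmod w - R \<le> \<delta> k}"
    using assms by (intro finite_delta_ge) auto
qed

text \<open>
  The number of zeros close to a point is of the order of the permitted exponent, so a constant factor
  per near zero is harmless.
\<close>

lemma near_card_le:
  obtains K where "K > 0"
    "\<And>N w. \<lbrakk>finite N; cmod w < 1; \<And>j. j \<in> N \<Longrightarrow> cmod (z j - w) \<le> (1 - cmod w) / 2\<rbrakk> \<Longrightarrow>
       real (card N) \<le> K * (1 - cmod w) powr (-\<rho>)"
proof (rule that[of "361 * (1 + C / ln 2) * 2 powr \<rho>"])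
  show "361 * (1 + C / ln 2) * 2 powr \<rho> > 0"
    using C_pos by (intro mult_pos_pos add_pos_pos) auto
  fix N :: "nat set" and w :: complex
  assume N: "finite N" "cmod w < 1" and near: "\<And>j. j \<in> N \<Longrightarrow> cmod (z j - w) \<le> (1 - cmod w) / 2"
  define R where "R = (1 - cmod w) / 2"
  have R: "R > 0" using N by (simp add: R_def)
  have "real (card N) \<le> 361 * (R / R)\<^sup>2 * ((1 + C / ln 2) * R powr (-\<rho>))"
  proof (rule disc_card_le)
    show "R \<le> \<delta> j" if "j \<in> N" for j
      using delta_ge_near[OF near[OF that]] by (simp add: R_def field_simps)
  qed (use N near R in \<open>auto simp: R_def\<close>)
  also have "\<dots> = 361 * (1 + C / ln 2) * R powr (-\<rho>)" using R by simp
  also have "\<dots> \<le> 361 * (1 + C / ln 2) * (2 powr \<rho> * (1 - cmod w) powr (-\<rho>))"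
    using N C_pos rho by (intro mult_left_mono half_powr_minus) (auto simp: R_def)
  finally show "real (card N) \<le> 361 * (1 + C / ln 2) * 2 powr \<rho> * (1 - cmod w) powr (-\<rho>)"
    by (simp add: mult_ac)
qed

text \<open>
  The index set is a parameter because the product with one factor left out measures the derivative of
  the full product at the omitted zero and is the building block of the interpolation series.
\<close>

definition canonical :: "nat set \<Rightarrow> complex \<Rightarrow> complex" where
  "canonical I w = lim (\<lambda>n. \<Prod>j<n. if j \<in> I then E j w else 1)"

lemma partial_product_eq: "(\<Prod>j<n. if j \<in> I then E j w else 1) = (\<Prod>j\<in>{..<n} \<inter> I. E j w)"
  by (simp add: prod.inter_restrict)

lemma canonical_uniform_limit:
  assumes "r < 1"
  shows "uniform_limit (cball 0 r) (\<lambda>n w. \<Prod>j<n. if j \<in> I then E j w else 1) (canonical I) sequentially"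
proof -
  obtain K where K: "K > 0" "\<And>k w. cmod w < 1 \<Longrightarrow> cmod (E k w - 1) \<le> K * (\<delta> k / D k w) ^ m"
    using E_estimates by metis
  have sub: "cball 0 r \<subseteq> ball (0::complex) 1" using assms by auto
  have cont: "continuous_on (cball 0 r) (\<lambda>w. if j \<in> I then E j w else 1)" for j
    using holomorphic_on_imp_continuous_on[OF holomorphic_on_subset[OF E_holomorphic sub]]
    by (cases "j \<in> I") auto
  have "uniformly_convergent_on (cball 0 r) (\<lambda>n w. \<Sum>j<n. cmod ((if j \<in> I then E j w else 1) - 1))"
  proof (rule Weierstrass_m_test')
    show "summable (\<lambda>j. K / (1 - r) ^ m * \<delta> j ^ m)"
      by (intro summable_mult summable_delta)
    fix j and w :: complex assume "w \<in> cball 0 r"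
    hence w: "cmod w \<le> r" "cmod w < 1" using assms by auto
    have "cmod ((if j \<in> I then E j w else 1) - 1) \<le> K * (\<delta> j / D j w) ^ m"
      using K(2)[OF w(2), of j] order_trans[OF norm_ge_zero K(2)[OF w(2), of j]]
      by (cases "j \<in> I") simp_all
    also have "\<dots> \<le> K * (\<delta> j / (1 - r)) ^ m"
      using K(1) delta_pos[of j] D_ge(2)[OF w(2), of j] w assms
      by (intro mult_left_mono power_mono divide_left_mono) (auto intro: less_imp_le)
    also have "\<dots> = K / (1 - r) ^ m * \<delta> j ^ m" by (simp add: power_divide)
    finally show "norm (cmod ((if j \<in> I then E j w else 1) - 1)) \<le> K / (1 - r) ^ m * \<delta> j ^ m"
      by simp
  qed
  hence "uniformly_convergent_on (cball 0 r) (\<lambda>n w. \<Prod>j<n. if j \<in> I then E j w else 1)"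
    by (intro uniformly_convergent_on_prod' cont) auto
  thus ?thesis
    unfolding uniformly_convergent_uniform_limit_iff canonical_def .
qed

lemma canonical_tendsto:
  assumes "cmod w < 1"
  shows "(\<lambda>n. \<Prod>j<n. if j \<in> I then E j w else 1) \<longlonglongrightarrow> canonical I w"
  using tendsto_uniform_limitI[OF canonical_uniform_limit[OF assms], of w] by simp

lemma canonical_holomorphic [holomorphic_intros]: "canonical I holomorphic_on ball 0 1"
proof (rule holomorphic_uniform_limit_disc)
  show "(\<lambda>w. \<Prod>j<n. if j \<in> I then E j w else 1) holomorphic_on ball 0 1" for n
    unfolding partial_product_eq by (intro holomorphic_intros)
qed (rule canonical_uniform_limit)

lemma canonical_remove:
  assumes "k \<in> I" "cmod w < 1"
  shows "canonical I w = E k w * canonical (I - {k}) w"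
proof (rule LIMSEQ_unique[OF canonical_tendsto])
  have "eventually (\<lambda>n. E k w * (\<Prod>j<n. if j \<in> I - {k} then E j w else 1)
          = (\<Prod>j<n. if j \<in> I then E j w else 1)) sequentially"
    using eventually_gt_at_top[of k]
  proof eventually_elim
    case (elim n)
    have "{..<n} \<inter> (I - {k}) = ({..<n} \<inter> I) - {k}" by auto
    thus ?case unfolding partial_product_eq
      using prod.remove[of "{..<n} \<inter> I" k "\<lambda>j. E j w"] elim assms by simp
  qed
  moreover have "(\<lambda>n. E k w * (\<Prod>j<n. if j \<in> I - {k} then E j w else 1))
      \<longlonglongrightarrow> E k w * canonical (I - {k}) w"
    by (intro tendsto_mult tendsto_const canonical_tendsto assms)
  ultimately show "(\<lambda>n. \<Prod>j<n. if j \<in> I then E j w else 1) \<longlonglongrightarrow> E k w * canonical (I - {k}) w"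
    by (rule Lim_transform_eventually[rotated])
qed (rule assms)

lemma canonical_estimates:
  obtains K where "K > 0"
    "\<And>I w. cmod w < 1 \<Longrightarrow> cmod (canonical I w) \<le> exp (K * (1 - cmod w) powr (-\<rho>))"
    "\<And>I N w. \<lbrakk>cmod w < 1; finite N; N \<subseteq> I; \<And>j. j \<in> I - N \<Longrightarrow> (1 - cmod w) / 4 \<le> cmod (z j - w)\<rbrakk> \<Longrightarrow>
       (\<Prod>j\<in>N. cmod (z j - w) / D j w) * exp (- K * (1 - cmod w) powr (-\<rho>)) \<le> cmod (canonical I w)"
proof -
  obtain K where K: "K > 0"
    "\<And>I w. \<lbrakk>finite I; cmod w < 1\<rbrakk> \<Longrightarrow> cmod (\<Prod>j\<in>I. E j w) \<le> exp (K * (1 - cmod w) powr (-\<rho>))"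
    "\<And>I N w. \<lbrakk>finite I; cmod w < 1; N \<subseteq> I; \<And>j. j \<in> I - N \<Longrightarrow> (1 - cmod w) / 4 \<le> cmod (z j - w)\<rbrakk> \<Longrightarrow>
       (\<Prod>j\<in>N. cmod (z j - w) / D j w) * exp (- K * (1 - cmod w) powr (-\<rho>)) \<le> cmod (\<Prod>j\<in>I. E j w)"
    using finite_product_estimates by blast
  show ?thesis
  proof (rule that[OF K(1)])
    fix I :: "nat set" and w :: complex assume w: "cmod w < 1"
    have lim: "(\<lambda>n. cmod (\<Prod>j<n. if j \<in> I then E j w else 1)) \<longlonglongrightarrow> cmod (canonical I w)"
      by (intro tendsto_norm canonical_tendsto w)
    show "cmod (canonical I w) \<le> exp (K * (1 - cmod w) powr (-\<rho>))"
    proof (rule tendsto_upperbound[OF lim])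
      show "\<forall>\<^sub>F n in sequentially. cmod (\<Prod>j<n. if j \<in> I then E j w else 1) \<le> exp (K * (1 - cmod w) powr (-\<rho>))"
        unfolding partial_product_eq using K(2) w by simp
    qed simp
    fix N assume N: "finite N" "N \<subseteq> I" and far: "\<And>j. j \<in> I - N \<Longrightarrow> (1 - cmod w) / 4 \<le> cmod (z j - w)"
    show "(\<Prod>j\<in>N. cmod (z j - w) / D j w) * exp (- K * (1 - cmod w) powr (-\<rho>)) \<le> cmod (canonical I w)"
    proof (rule tendsto_lowerbound[OF lim])
      obtain n0 where n0: "N \<subseteq> {..<n0}" using N finite_nat_bounded by blast
      show "\<forall>\<^sub>F n in sequentially. (\<Prod>j\<in>N. cmod (z j - w) / D j w) * exp (- K * (1 - cmod w) powr (-\<rho>))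
          \<le> cmod (\<Prod>j<n. if j \<in> I then E j w else 1)"
        using eventually_ge_at_top[of n0]
      proof eventually_elim
        case (elim n)
        show ?case unfolding partial_product_eq
          by (rule K(3)) (use N n0 w elim far in auto)
      qed
    qed simp
  qed
qed

lemma E_node: "E k (z k) = 0"
proof -
  have "1 - A k (z k) = 0" using one_minus_A[OF in_disc[of k], of k] by simp
  thus ?thesis by (simp add: E_def)
qed

lemma canonical_node: "k \<in> I \<Longrightarrow> canonical I (z k) = 0"
  using canonical_remove[of k I "z k"] in_disc by (simp add: E_node)

lemma canonical_nonzero:
  assumes "cmod w < 1" "w \<notin> z ` I"
  shows "canonical I w \<noteq> 0"
proof -
  obtain K where K: "K > 0"
    "\<And>I w. cmod w < 1 \<Longrightarrow> cmod (canonical I w) \<le> exp (K * (1 - cmod w) powr (-\<rho>))"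
    "\<And>I N w. \<lbrakk>cmod w < 1; finite N; N \<subseteq> I; \<And>j. j \<in> I - N \<Longrightarrow> (1 - cmod w) / 4 \<le> cmod (z j - w)\<rbrakk> \<Longrightarrow>
       (\<Prod>j\<in>N. cmod (z j - w) / D j w) * exp (- K * (1 - cmod w) powr (-\<rho>)) \<le> cmod (canonical I w)"
    using canonical_estimates by blast
  define N where "N = {k. cmod (z k - w) \<le> (1 - cmod w) / 4} \<inter> I"
  have "finite N" unfolding N_def using assms by (intro finite_Int disjI1 finite_near) auto
  hence "(\<Prod>j\<in>N. cmod (z j - w) / D j w) * exp (- K * (1 - cmod w) powr (-\<rho>)) \<le> cmod (canonical I w)"
    using assms by (intro K(3)) (auto simp: N_def)
  moreover have "(\<Prod>j\<in>N. cmod (z j - w) / D j w) > 0"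
    using assms by (intro prod_pos divide_pos_pos D_ge(3)) (auto simp: N_def)
  hence "(\<Prod>j\<in>N. cmod (z j - w) / D j w) * exp (- K * (1 - cmod w) powr (-\<rho>)) > 0"
    by (intro mult_pos_pos) auto
  ultimately show ?thesis by auto
qed

text \<open>
  At a zero \<open>z k\<close> the near factors are those with \<open>cmod (z j - z k) \<le> \<delta> k / 2\<close>.  Up to a factor
  \<open>5\<close> for each of them, their product is the exponential of minus the logarithmic sum in \<open>log_sum_le\<close>.
  This is where that assumption enters at full strength.
\<close>

lemma canonical_omit_node_ge:
  obtains K where "K > 0" "\<And>k. exp (- K * \<delta> k powr (-\<rho>)) \<le> cmod (canonical (- {k}) (z k))"
proof -
  obtain K where K: "K > 0"
    "\<And>I w. cmod w < 1 \<Longrightarrow> cmod (canonical I w) \<le> exp (K * (1 - cmod w) powr (-\<rho>))"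
    "\<And>I N w. \<lbrakk>cmod w < 1; finite N; N \<subseteq> I; \<And>j. j \<in> I - N \<Longrightarrow> (1 - cmod w) / 4 \<le> cmod (z j - w)\<rbrakk> \<Longrightarrow>
       (\<Prod>j\<in>N. cmod (z j - w) / D j w) * exp (- K * (1 - cmod w) powr (-\<rho>)) \<le> cmod (canonical I w)"
    using canonical_estimates by blast
  obtain L where L: "L > 0"
    "\<And>N w. \<lbrakk>finite N; cmod w < 1; \<And>j. j \<in> N \<Longrightarrow> cmod (z j - w) \<le> (1 - cmod w) / 2\<rbrakk> \<Longrightarrow>
       real (card N) \<le> L * (1 - cmod w) powr (-\<rho>)"
    using near_card_le by blast
  show ?thesis
  proof (rule that[of "C + ln 5 * L + K"])
    show "C + ln 5 * L + K > 0" using C_pos K L by (intro add_pos_pos mult_pos_pos) auto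
    fix k
    define N where "N = {j. cmod (z j - z k) \<le> \<delta> k / 2} \<inter> - {k}"
    have fin: "finite N"
      unfolding N_def using delta_pos[of k] by (intro finite_Int disjI1 finite_near) (simp add: \<delta>_def)
    define s where "s = (\<lambda>j. ln (\<delta> k / (2 * cmod (z j - z k))))"
    have near: "cmod (z j - z k) \<le> (1 - cmod (z k)) / 2" if "j \<in> N" for j
      using that by (simp add: N_def \<delta>_def)
    have 1: "(\<Sum>j\<in>N. s j) \<le> C * \<delta> k powr (-\<rho>)"
      using log_sum_le[OF fin, of k] near by (simp add: s_def \<delta>_def N_def)
    have 2: "ln 5 * real (card N) \<le> ln 5 * (L * \<delta> k powr (-\<rho>))"
      using L(2)[OF fin in_disc[of k]] near by (intro mult_left_mono) (auto simp: \<delta>_def)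
    have "(\<Sum>j\<in>N. s j + ln 5) = (\<Sum>j\<in>N. s j) + ln 5 * real (card N)"
      by (simp add: sum.distrib)
    also note add_mono[OF 1 2]
    also have "C * \<delta> k powr (-\<rho>) + ln 5 * (L * \<delta> k powr (-\<rho>)) = (C + ln 5 * L) * \<delta> k powr (-\<rho>)"
      by (simp add: ring_distribs)
    finally have sum: "(\<Sum>j\<in>N. s j + ln 5) \<le> (C + ln 5 * L) * \<delta> k powr (-\<rho>)" .
    have "exp (- (C + ln 5 * L + K) * \<delta> k powr (-\<rho>))
        = exp (- ((C + ln 5 * L) * \<delta> k powr (-\<rho>))) * exp (- K * \<delta> k powr (-\<rho>))"
      by (simp add: exp_add [symmetric] algebra_simps)
    also have "\<dots> \<le> exp (\<Sum>j\<in>N. - (s j + ln 5)) * exp (- K * \<delta> k powr (-\<rho>))"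
      unfolding sum_negf using sum by (intro mult_right_mono) auto
    also have "exp (\<Sum>j\<in>N. - (s j + ln 5)) = (\<Prod>j\<in>N. exp (- (s j + ln 5)))"
      by (rule exp_sum[OF fin])
    also have "\<dots> \<le> (\<Prod>j\<in>N. cmod (z j - z k) / D j (z k))"
    proof (intro prod_mono conjI)
      fix j assume j: "j \<in> N"
      define d where "d = cmod (z j - z k)"
      have d: "d > 0" "d \<le> \<delta> k / 2"
        using j inj by (auto simp: N_def d_def dest: injD)
      have "exp (- (s j + ln 5)) = 1 / (\<delta> k / (2 * d) * 5)"
      proof -
        have "0 < \<delta> k / (2 * d)" using d delta_pos[of k] by simp
        thus ?thesis
          unfolding s_def d_def [symmetric] exp_minus exp_add by (simp only: exp_ln) (simp add: inverse_eq_divide)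
      qed
      also have "\<dots> = d / (5 / 2 * \<delta> k)" using d delta_pos[of k] by (simp add: field_simps)
      also have "\<dots> \<le> d / D j (z k)"
        using D_le[of "z k" j] D_ge(3)[OF in_disc[of k], of j] in_disc[of k] d delta_pos[of k]
        by (intro divide_left_mono) (auto simp: \<delta>_def d_def)
      finally show "exp (- (s j + ln 5)) \<le> cmod (z j - z k) / D j (z k)" by (simp add: d_def)
    qed auto
    also have "(\<Prod>j\<in>N. cmod (z j - z k) / D j (z k)) * exp (- K * \<delta> k powr (-\<rho>)) \<le> cmod (canonical (- {k}) (z k))"
      unfolding \<delta>_def
      by (rule K(3)[OF in_disc fin]) (use delta_pos[of k] in \<open>auto simp: N_def \<delta>_def\<close>)
    finally show "exp (- (C + ln 5 * L + K) * \<delta> k powr (-\<rho>)) \<le> cmod (canonical (- {k}) (z k))"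
      by simp
  qed
qed

text \<open>
  For division by the product: the zeros near \<open>w\<close> are collected in a polynomial, scaled by
  \<open>(1 - cmod w) / 4\<close>, and the canonical product is, up to the permitted exponential, at least as large as this polynomial.
\<close>

lemma near_product_le:
  obtains K where "K > 0"
    "\<And>w. cmod w < 1 \<Longrightarrow> (\<Prod>j\<in>{j. cmod (z j - w) \<le> (1 - cmod w) / 4}. cmod (w - z j) / ((1 - cmod w) / 4))
        \<le> exp (K * (1 - cmod w) powr (-\<rho>)) * cmod (canonical UNIV w)"
proof -
  obtain K where K: "K > 0"
    "\<And>I w. cmod w < 1 \<Longrightarrow> cmod (canonical I w) \<le> exp (K * (1 - cmod w) powr (-\<rho>))"
    "\<And>I N w. \<lbrakk>cmod w < 1; finite N; N \<subseteq> I; \<And>j. j \<in> I - N \<Longrightarrow> (1 - cmod w) / 4 \<le> cmod (z j - w)\<rbrakk> \<Longrightarrow>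
       (\<Prod>j\<in>N. cmod (z j - w) / D j w) * exp (- K * (1 - cmod w) powr (-\<rho>)) \<le> cmod (canonical I w)"
    using canonical_estimates by blast
  obtain L where L: "L > 0"
    "\<And>N w. \<lbrakk>finite N; cmod w < 1; \<And>j. j \<in> N \<Longrightarrow> cmod (z j - w) \<le> (1 - cmod w) / 2\<rbrakk> \<Longrightarrow>
       real (card N) \<le> L * (1 - cmod w) powr (-\<rho>)"
    using near_card_le by blast
  show ?thesis
  proof (rule that[of "ln 9 * L + K"])
    show "ln 9 * L + K > 0" using K L by (intro add_pos_pos mult_pos_pos) auto
    fix w :: complex assume w: "cmod w < 1"
    define N where "N = {j. cmod (z j - w) \<le> (1 - cmod w) / 4}"
    define y where "y = (1 - cmod w) powr (-\<rho>)"
    have fin: "finite N" unfolding N_def using w by (intro finite_near) auto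
    have prod_nonneg: "(\<Prod>j\<in>N. cmod (z j - w) / D j w) \<ge> 0"
      by (intro prod_nonneg) (auto simp: D_def)
    have "(\<Prod>j\<in>N. cmod (w - z j) / ((1 - cmod w) / 4)) \<le> (\<Prod>j\<in>N. 9 * (cmod (z j - w) / D j w))"
    proof (intro prod_mono conjI)
      fix j assume j: "j \<in> N"
      have "D j w \<le> 9 * ((1 - cmod w) / 4)"
        using D_le[of w j] j w by (simp add: N_def)
      hence "cmod (z j - w) * D j w \<le> cmod (z j - w) * (9 * ((1 - cmod w) / 4))"
        by (intro mult_left_mono) auto
      thus "cmod (w - z j) / ((1 - cmod w) / 4) \<le> 9 * (cmod (z j - w) / D j w)"
        using w D_ge(3)[OF w, of j] by (simp add: field_simps norm_minus_commute)
    qed (use w in auto)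
    also have "\<dots> = 9 ^ card N * (\<Prod>j\<in>N. cmod (z j - w) / D j w)"
      by (simp add: prod.distrib prod_dividef)
    also have "(9 :: real) ^ card N = exp (ln 9 * real (card N))"
      by (simp add: exp_of_nat2_mult)
    also have "\<dots> * (\<Prod>j\<in>N. cmod (z j - w) / D j w) \<le> exp (ln 9 * (L * y)) * (\<Prod>j\<in>N. cmod (z j - w) / D j w)"
      using L(2)[OF fin w] w prod_nonneg
      by (intro mult_right_mono) (auto simp: N_def y_def intro!: mult_left_mono)
    also have "\<dots> = exp ((ln 9 * L + K) * y) * ((\<Prod>j\<in>N. cmod (z j - w) / D j w) * exp (- K * y))"
      by (simp add: exp_add [symmetric] exp_minus ring_distribs field_simps)
    also have "\<dots> \<le> exp ((ln 9 * L + K) * y) * cmod (canonical UNIV w)"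
      unfolding y_def using w fin by (intro mult_left_mono K(3)) (auto simp: N_def)
    finally show "(\<Prod>j\<in>{j. cmod (z j - w) \<le> (1 - cmod w) / 4}. cmod (w - z j) / ((1 - cmod w) / 4))
        \<le> exp ((ln 9 * L + K) * (1 - cmod w) powr (-\<rho>)) * cmod (canonical UNIV w)"
      by (simp add: N_def y_def)
  qed
qed

end

section \<open>Interpolation\<close>

context sparse_sequence
begin

text \<open>
  The damping factor: it is \<open>1\<close> at its node \<open>z k\<close>, at most \<open>2\<close> everywhere, and less than \<open>exp (-1)\<close>
  as soon as \<open>z k\<close> is much closer to the circle than \<open>w\<close> is.
\<close>

definition W :: "nat \<Rightarrow> complex \<Rightarrow> complex" where
  "W k w = of_real (1 - (cmod (z k))\<^sup>2) / (1 - cnj (z k) * w)"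

lemma W_holomorphic [holomorphic_intros]: "W k holomorphic_on ball 0 1"
  unfolding W_def using denominator_nonzero by (intro holomorphic_intros) auto

lemma W_node: "W k (z k) = 1"
proof -
  have "1 - cnj (z k) * z k = of_real (1 - (cmod (z k))\<^sup>2)"
    by (simp add: complex_norm_square mult.commute del: of_real_power)
  moreover have "1 - cnj (z k) * z k \<noteq> 0" using denominator_nonzero[OF in_disc] .
  ultimately show ?thesis by (simp add: W_def)
qed

lemma norm_W_le:
  assumes "cmod w < 1"
  shows "cmod (W k w) \<le> 2 * (\<delta> k / D k w)"
proof -
  have "(cmod (z k))\<^sup>2 \<le> 1" using in_disc[of k] by (simp add: power_le_one)
  hence "\<bar>1 - (cmod (z k))\<^sup>2\<bar> = \<delta> k * (1 + cmod (z k))"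
    by (simp add: \<delta>_def algebra_simps power2_eq_square)
  also have "\<dots> \<le> \<delta> k * 2" using in_disc[of k] delta_pos[of k] by (intro mult_left_mono) auto
  finally have "\<bar>1 - (cmod (z k))\<^sup>2\<bar> / D k w \<le> \<delta> k * 2 / D k w"
    by (intro divide_right_mono) (auto simp: D_def)
  thus ?thesis unfolding W_def norm_divide norm_of_real D_def by (simp add: mult.commute)
qed

text \<open>
  The power \<open>n k\<close> is \<open>T * \<delta> k powr (-\<rho>)\<close>, rounded up, for a constant \<open>T\<close>.  If \<open>cmod (W k w) \<le> exp (-1)\<close>, it beats the
  growing factor and even leaves the summable \<open>\<delta> k ^ m\<close>.  Otherwise \<open>6 * \<delta> k\<close> exceeds
  \<open>1 - cmod w\<close>, so that \<open>\<delta> k powr (-\<rho>)\<close> is at most a multiple of \<open>(1 - cmod w) powr (-\<rho>)\<close>.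
\<close>

lemma damping:
  fixes B :: real
  assumes "B > 0"
  obtains n M where "M > 0"
    "\<And>k w. cmod w < 1 \<Longrightarrow> exp (B * \<delta> k powr (-\<rho>)) * cmod (W k w) ^ n k
        \<le> exp (M * (1 - cmod w) powr (-\<rho>)) * \<delta> k ^ m"
proof -
  define T where "T = B + real m / \<rho>"
  have T: "T > 0" using assms rho by (auto simp: T_def intro!: add_pos_nonneg)
  define n where "n k = nat \<lceil>T * \<delta> k powr (-\<rho>)\<rceil>" for k
  have y: "1 \<le> \<delta> k powr (-\<rho>)" for k
    using delta_pos delta_le_1 rho by (intro powr_minus_ge_1) auto
  have n: "T * \<delta> k powr (-\<rho>) \<le> real (n k)" "real (n k) \<le> T * \<delta> k powr (-\<rho>) + 1" for k
  proof -
    have "T * \<delta> k powr (-\<rho>) \<ge> 0" using T by simp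
    thus "T * \<delta> k powr (-\<rho>) \<le> real (n k)" "real (n k) \<le> T * \<delta> k powr (-\<rho>) + 1"
      unfolding n_def by linarith+
  qed
  \<comment> \<open>The part \<open>real m / \<rho>\<close> of \<open>T\<close> pays for the factor \<open>\<delta> k ^ m\<close> to be gained.\<close>
  have delta_pow: "exp (- (real m / \<rho>) * \<delta> k powr (-\<rho>)) \<le> \<delta> k ^ m" for k
  proof -
    have "1 / \<delta> k ^ m = \<delta> k powr (- real m)"
      using delta_pos[of k] by (simp add: powr_minus powr_realpow inverse_eq_divide)
    also have "\<dots> \<le> exp (real m / \<rho> * \<delta> k powr (-\<rho>))"
      using rho delta_pos by (intro powr_minus_le_exp) auto
    finally show ?thesis using delta_pos[of k] by (simp add: exp_minus field_simps)
  qed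
  show ?thesis
  proof (rule that[of "(2 * T + 1) * 6 powr \<rho>" n])
    show "(2 * T + 1) * 6 powr \<rho> > 0" using T by (intro mult_pos_pos) auto
    fix k and w :: complex assume w: "cmod w < 1"
    define x where "x = (1 - cmod w) powr (-\<rho>)"
    define d where "d = \<delta> k powr (-\<rho>)"
    have d: "d \<ge> 1" unfolding d_def by (rule y)
    have x: "x \<ge> 0" by (simp add: x_def)
    \<comment> \<open>The claim in logarithmic form.  Here \<open>ln_bound\<close> is an upper bound for the logarithm of
      \<open>cmod (W k w) ^ n k\<close>, and the two alternatives are the cases described above.\<close>
    have exponent: "B * d + ln_bound \<le> (2 * T + 1) * 6 powr \<rho> * x - real m / \<rho> * d"
      if "ln_bound \<le> - real (n k) \<or> ln_bound \<le> real (n k) \<and> d \<le> 6 powr \<rho> * x" for ln_bound :: real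
    proof -
      have Bd: "B * d = T * d - real m / \<rho> * d" by (simp add: T_def ring_distribs)
      from that show ?thesis
      proof
        assume "ln_bound \<le> - real (n k)"
        moreover have "(2 * T + 1) * 6 powr \<rho> * x \<ge> 0"
          using T x by (intro mult_nonneg_nonneg) auto
        ultimately show ?thesis using n(1)[of k] Bd unfolding d_def by linarith
      next
        assume *: "ln_bound \<le> real (n k) \<and> d \<le> 6 powr \<rho> * x"
        hence "(2 * T + 1) * d \<le> (2 * T + 1) * (6 powr \<rho> * x)"
          using T by (intro mult_left_mono) auto
        moreover have "ln_bound \<le> T * d + d" using * n(2)[of k] d by (simp add: d_def)
        moreover have "(2 * T + 1) * d = T * d + (T * d + d)" by (simp add: ring_distribs)
        ultimately show ?thesis using Bd by (simp add: mult.assoc)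
      qed
    qed
    have "exp (B * d) * cmod (W k w) ^ n k \<le> exp ((2 * T + 1) * 6 powr \<rho> * x) * exp (- (real m / \<rho>) * d)"
    proof (cases "cmod (W k w) \<le> exp (-1)")
      case True
      have "exp (B * d) * cmod (W k w) ^ n k \<le> exp (B * d) * exp (-1) ^ n k"
        using True by (intro mult_left_mono power_mono) auto
      also have "\<dots> = exp (B * d + - real (n k))"
        by (simp add: exp_of_nat_mult [symmetric] exp_add [symmetric] del: exp_diff)
      also have "\<dots> \<le> exp ((2 * T + 1) * 6 powr \<rho> * x - real m / \<rho> * d)"
        using exponent[of "- real (n k)"] by simp
      finally show ?thesis by (simp add: exp_add [symmetric])
    next
      case False
      have "exp (1 :: real) < 3" using e_less_272 by simp
      hence "1 / 3 < exp (-1 :: real)" by (simp add: exp_minus field_simps)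
      hence "1 / 3 < 2 * (\<delta> k / D k w)" using False norm_W_le[OF w, of k] by linarith
      hence "D k w < 6 * \<delta> k" using D_ge(3)[OF w, of k] by (simp add: field_simps)
      hence "(1 - cmod w) / 6 \<le> \<delta> k" using D_ge(2)[OF w, of k] by simp
      hence "d \<le> ((1 - cmod w) / 6) powr (-\<rho>)"
        unfolding d_def using w rho by (intro powr_mono2') auto
      also have "\<dots> = 6 powr \<rho> * x"
        using w by (simp add: x_def powr_divide powr_minus field_simps)
      finally have dx: "d \<le> 6 powr \<rho> * x" .
      have "\<delta> k / D k w \<le> 1" using D_ge[OF w, of k] by simp
      hence "cmod (W k w) \<le> 2" using norm_W_le[OF w, of k] by linarith
      hence "cmod (W k w) \<le> exp 1" using exp_ge_add_one_self[of 1] by linarith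
      hence "exp (B * d) * cmod (W k w) ^ n k \<le> exp (B * d) * exp 1 ^ n k"
        by (intro mult_left_mono power_mono) auto
      also have "\<dots> = exp (B * d + real (n k))"
        by (simp add: exp_of_nat_mult [symmetric] exp_add [symmetric])
      also have "\<dots> \<le> exp ((2 * T + 1) * 6 powr \<rho> * x - real m / \<rho> * d)"
        using exponent[of "real (n k)"] dx by simp
      finally show ?thesis by (simp add: exp_add [symmetric])
    qed
    also have "\<dots> \<le> exp ((2 * T + 1) * 6 powr \<rho> * x) * \<delta> k ^ m"
      unfolding d_def by (intro mult_left_mono delta_pow) auto
    finally show "exp (B * \<delta> k powr (-\<rho>)) * cmod (W k w) ^ n k
        \<le> exp ((2 * T + 1) * 6 powr \<rho> * (1 - cmod w) powr (-\<rho>)) * \<delta> k ^ m"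
      by (simp add: d_def x_def)
  qed
qed

text \<open>
  Lagrange interpolation with damping: the \<open>k\<close>-th term vanishes at the other nodes because
  \<open>canonical (- {k})\<close> does, and \<open>damping\<close> makes the series converge although the data grow.
\<close>

lemma interpolation:
  assumes "B > 0" and b: "\<And>k. cmod (b k) \<le> exp (B * \<delta> k powr (-\<rho>))"
  obtains h where "moderate_growth \<rho> h" "\<And>k. h (z k) = b k"
proof -
  obtain K where K: "K > 0"
    "\<And>I w. cmod w < 1 \<Longrightarrow> cmod (canonical I w) \<le> exp (K * (1 - cmod w) powr (-\<rho>))"
    using canonical_estimates by metis
  obtain L where L: "L > 0" "\<And>k. exp (- L * \<delta> k powr (-\<rho>)) \<le> cmod (canonical (- {k}) (z k))"
    using canonical_omit_node_ge by metis
  obtain n M where M: "M > 0"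
    "\<And>k w. cmod w < 1 \<Longrightarrow> exp ((B + L) * \<delta> k powr (-\<rho>)) * cmod (W k w) ^ n k
        \<le> exp (M * (1 - cmod w) powr (-\<rho>)) * \<delta> k ^ m"
    using damping[of "B + L"] \<open>B > 0\<close> L(1) by (metis add_pos_pos)
  define t where "t k w = b k * (canonical (- {k}) w / canonical (- {k}) (z k)) * W k w ^ n k" for k w
  have nonzero: "canonical (- {k}) (z k) \<noteq> 0" for k
    using L(2)[of k] exp_gt_zero[of "- L * \<delta> k powr (-\<rho>)"] by force
  have t_holo: "t k holomorphic_on ball 0 1" for k
    unfolding t_def using nonzero by (intro holomorphic_intros) auto
  have t_le: "cmod (t k w) \<le> exp ((K + M) * (1 - cmod w) powr (-\<rho>)) * \<delta> k ^ m" if w: "cmod w < 1" for k w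
  proof -
    define x where "x = (1 - cmod w) powr (-\<rho>)"
    define d where "d = \<delta> k powr (-\<rho>)"
    have "cmod (t k w) = cmod (b k) * (cmod (canonical (- {k}) w) / cmod (canonical (- {k}) (z k))) * cmod (W k w) ^ n k"
      by (simp add: t_def norm_mult norm_divide norm_power)
    also have "\<dots> \<le> exp (B * d) * (exp (K * x) / exp (- L * d)) * cmod (W k w) ^ n k"
      using b[of k] K(2)[OF w, of "- {k}"] L(2)[of k] unfolding d_def x_def
      by (intro mult_mono frac_le) auto
    also have "\<dots> = exp (K * x) * (exp ((B + L) * d) * cmod (W k w) ^ n k)"
      by (simp add: exp_minus exp_add ring_distribs field_simps)
    also have "\<dots> \<le> exp (K * x) * (exp (M * x) * \<delta> k ^ m)"
      unfolding d_def x_def by (intro mult_left_mono M(2) w) auto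
    also have "\<dots> = exp ((K + M) * x) * \<delta> k ^ m"
      by (simp add: exp_add ring_distribs)
    finally show ?thesis by (simp add: x_def)
  qed
  define h where "h w = (\<Sum>k. t k w)" for w
  have h_lim: "uniform_limit (cball 0 r) (\<lambda>N w. \<Sum>k<N. t k w) h sequentially" if "r < 1" for r
    unfolding h_def
  proof (rule Weierstrass_m_test)
    show "summable (\<lambda>k. exp ((K + M) * (1 - r) powr (-\<rho>)) * \<delta> k ^ m)"
      by (intro summable_mult summable_delta)
    fix k and w :: complex assume "w \<in> cball 0 r"
    hence w: "cmod w \<le> r" "cmod w < 1" using that by auto
    have "(1 - cmod w) powr (-\<rho>) \<le> (1 - r) powr (-\<rho>)"
      using w that rho by (intro powr_mono2') auto
    hence "exp ((K + M) * (1 - cmod w) powr (-\<rho>)) * \<delta> k ^ m \<le> exp ((K + M) * (1 - r) powr (-\<rho>)) * \<delta> k ^ m"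
      using K(1) M(1) delta_pos[of k] by (intro mult_right_mono) auto
    thus "norm (t k w) \<le> exp ((K + M) * (1 - r) powr (-\<rho>)) * \<delta> k ^ m"
      using t_le[OF w(2), of k] by linarith
  qed
  define S where "S = (\<Sum>k. \<delta> k ^ m)"
  have S: "S \<ge> 0"
    unfolding S_def using delta_pos by (intro suminf_nonneg summable_delta) (auto intro: less_imp_le)
  have "moderate_growth \<rho> h"
  proof (rule moderate_growthI[where C = "K + M + S"])
    show "h holomorphic_on ball 0 1"
    proof (rule holomorphic_uniform_limit_disc)
      show "(\<lambda>w. \<Sum>k<N. t k w) holomorphic_on ball 0 1" for N
        by (intro holomorphic_intros t_holo)
    qed (rule h_lim)
    fix w :: complex assume w: "cmod w < 1"
    define x where "x = (1 - cmod w) powr (-\<rho>)"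
    have x: "x \<ge> 1" unfolding x_def using w rho by (intro powr_minus_ge_1) auto
    have "cmod (h w) \<le> (\<Sum>k. exp ((K + M) * x) * \<delta> k ^ m)"
      unfolding h_def x_def
      by (intro norm_suminf_le summable_mult summable_delta t_le w)
    also have "\<dots> = exp ((K + M) * x) * S"
      unfolding S_def by (rule suminf_mult[OF summable_delta])
    also have "S \<le> exp (S * x)"
      using exp_ge_add_one_self[of "S * x"] mult_left_mono[OF x S] by linarith
    hence "exp ((K + M) * x) * S \<le> exp ((K + M) * x) * exp (S * x)" by simp
    also have "\<dots> = exp ((K + M + S) * x)" by (simp add: exp_add ring_distribs)
    finally show "cmod (h w) \<le> exp ((K + M + S) * (1 - cmod w) powr (-\<rho>))"
      by (simp add: x_def)
  qed
  moreover have "h (z j) = b j" for j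
  proof -
    have "t k (z j) = 0" if "k \<noteq> j" for k
      using that by (simp add: t_def canonical_node)
    hence "h (z j) = (\<Sum>k\<in>{j}. t k (z j))"
      unfolding h_def by (intro suminf_finite) auto
    also have "\<dots> = b j" using nonzero[of j] by (simp add: t_def W_node)
    finally show ?thesis .
  qed
  ultimately show ?thesis by (rule that)
qed

end

section \<open>Division by the canonical product and the differential equation\<close>

lemma holomorphic_factor_zero:
  assumes "f holomorphic_on S" "open S" "f a = 0"
  shows "\<exists>g. g holomorphic_on S \<and> (\<forall>v\<in>S. f v = (v - a) * g v) \<and> g a = deriv f a"
proof (intro exI conjI)
  show "(\<lambda>v. if v = a then deriv f a else (f v - f a) / (v - a)) holomorphic_on S"
    by (rule pole_lemma_open[OF assms(1,2)])
qed (use assms(3) in auto)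

text \<open>
  A Schwarz lemma for several zeros: dividing \<open>f\<close> by the factors \<open>(v - a) / d\<close> does not
  increase its size on the circle, where they have modulus at least \<open>1\<close>.
\<close>

lemma cmod_le_zero_product:
  fixes f :: "complex \<Rightarrow> complex"
  assumes "finite Z" "f holomorphic_on S" "open S" "cball w R \<subseteq> S" "R > 0" "d > 0"
    and "\<And>a. a \<in> Z \<Longrightarrow> a \<in> S \<and> f a = 0"
    and "\<And>a v. a \<in> Z \<Longrightarrow> cmod (w - v) = R \<Longrightarrow> d \<le> cmod (v - a)"
    and "\<And>v. cmod (w - v) = R \<Longrightarrow> cmod (f v) \<le> M"
  shows "cmod (f w) \<le> M * (\<Prod>a\<in>Z. cmod (w - a) / d)"
  using assms(1,2,7-9)
proof (induction Z arbitrary: f M rule: finite_induct)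
  case empty
  have "cmod ((deriv ^^ 0) f w) \<le> fact 0 * M / R ^ 0"
  proof (rule Cauchy_inequality)
    show "f holomorphic_on ball w R" "continuous_on (cball w R) f"
      using empty.prems(1) assms(4) ball_subset_cball
      by (meson holomorphic_on_subset holomorphic_on_imp_continuous_on order_trans)+
  qed (use assms(5) empty in auto)
  thus ?case by simp
next
  case (insert a Z)
  have "f a = 0" using insert.prems(2) by simp
  then obtain g where g: "g holomorphic_on S" "\<And>v. v \<in> S \<Longrightarrow> f v = (v - a) * g v"
    using holomorphic_factor_zero[OF insert.prems(1) assms(3)] by blast
  have w: "w \<in> S" using assms(4,5) by auto
  have sphere: "v \<in> S" if "cmod (w - v) = R" for v
    using that assms(4) by (auto simp: dist_norm)
  have "cmod (g w) \<le> M / d * (\<Prod>a\<in>Z. cmod (w - a) / d)"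
  proof (rule insert.IH[OF g(1)])
    fix b assume b: "b \<in> Z"
    hence "b \<in> S" "f b = 0" "b \<noteq> a" using insert by auto
    thus "b \<in> S \<and> g b = 0" using g(2)[of b] by simp
    show "d \<le> cmod (v - b)" if "cmod (w - v) = R" for v
      using insert.prems(3) that b by blast
  next
    fix v assume v: "cmod (w - v) = R"
    have "d * cmod (g v) \<le> cmod (v - a) * cmod (g v)"
      using insert.prems(3)[of a v] v by (intro mult_right_mono) auto
    also have "\<dots> = cmod (f v)" using g(2)[OF sphere[OF v]] by (simp add: norm_mult)
    also have "\<dots> \<le> M" by (rule insert.prems(4)[OF v])
    finally show "cmod (g v) \<le> M / d" using assms(6) by (simp add: field_simps)
  qed
  hence "cmod (w - a) * cmod (g w) \<le> cmod (w - a) * (M / d * (\<Prod>a\<in>Z. cmod (w - a) / d))"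
    by (intro mult_left_mono) auto
  moreover have "cmod (f w) = cmod (w - a) * cmod (g w)"
    using g(2)[OF w] by (simp add: norm_mult)
  ultimately show ?case using insert.hyps by (simp add: mult_ac)
qed

text \<open>
  At a zero \<open>a\<close> of \<open>p\<close> both functions have a factor \<open>v - a\<close>; the cofactors take the values of the
  derivatives there, so their quotient is the completed function near \<open>a\<close>.
\<close>

lemma holomorphic_divide_simple_zeros:
  assumes f: "f holomorphic_on S" and p: "p holomorphic_on S" and "open S"
    and zeros: "\<And>a. a \<in> S \<Longrightarrow> p a = 0 \<Longrightarrow> f a = 0 \<and> deriv p a \<noteq> 0"
  shows "(\<lambda>v. if p v = 0 then deriv f v / deriv p v else f v / p v) holomorphic_on S" (is "?q holomorphic_on S")
proof -
  have open_nonzero: "open {v \<in> S. g v \<noteq> 0}" if "g holomorphic_on S" for g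
  proof -
    have "open (S \<inter> g -` (- {0}))"
      using that \<open>open S\<close> by (intro continuous_open_preimage holomorphic_on_imp_continuous_on) auto
    moreover have "S \<inter> g -` (- {0}) = {v \<in> S. g v \<noteq> 0}" by auto
    ultimately show ?thesis by simp
  qed
  have "?q field_differentiable at a" if a: "a \<in> S" for a
  proof (cases "p a = 0")
    case False
    have "(\<lambda>v. f v / p v) holomorphic_on {v \<in> S. p v \<noteq> 0}"
      using f p by (intro holomorphic_on_divide) (auto elim: holomorphic_on_subset)
    hence "?q holomorphic_on {v \<in> S. p v \<noteq> 0}"
      by (rule holomorphic_transform) auto
    thus ?thesis
      using holomorphic_on_imp_differentiable_at open_nonzero[OF p] a False by blast
  next
    case True
    obtain f1 where f1: "f1 holomorphic_on S" "\<And>v. v \<in> S \<Longrightarrow> f v = (v - a) * f1 v" "f1 a = deriv f a"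
      using holomorphic_factor_zero[OF f \<open>open S\<close>, of a] zeros[OF a True] by blast
    obtain p1 where p1: "p1 holomorphic_on S" "\<And>v. v \<in> S \<Longrightarrow> p v = (v - a) * p1 v" "p1 a = deriv p a"
      using holomorphic_factor_zero[OF p \<open>open S\<close> True] by blast
    have "(\<lambda>v. f1 v / p1 v) holomorphic_on {v \<in> S. p1 v \<noteq> 0}"
      using f1(1) p1(1) by (intro holomorphic_on_divide) (auto elim: holomorphic_on_subset)
    hence "?q holomorphic_on {v \<in> S. p1 v \<noteq> 0}"
      by (rule holomorphic_transform) (use f1 p1 in auto)
    thus ?thesis
      using holomorphic_on_imp_differentiable_at open_nonzero[OF p1(1)] a zeros[OF a True] p1(3) by force
  qed
  thus ?thesis
    by (auto simp: holomorphic_on_def intro: field_differentiable_at_within)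
qed

context sparse_sequence
begin

abbreviation P :: "complex \<Rightarrow> complex" where "P \<equiv> canonical UNIV"

lemma moderate_growth_P: "moderate_growth \<rho> P"
proof -
  obtain K where "\<And>I w. cmod w < 1 \<Longrightarrow> cmod (canonical I w) \<le> exp (K * (1 - cmod w) powr (-\<rho>))"
    using canonical_estimates by metis
  thus ?thesis by (intro moderate_growthI[where C = K] canonical_holomorphic)
qed

lemma P_eq_0_iff: "cmod w < 1 \<Longrightarrow> P w = 0 \<longleftrightarrow> w \<in> range z"
  using canonical_node[of _ UNIV] canonical_nonzero[of w UNIV] by auto

text \<open>
  Since \<open>P\<close> is \<open>(w - z k) * g w\<close> near the node, its derivative there is \<open>g (z k)\<close>, which is
  \<open>canonical (- {k}) (z k)\<close> up to factors bounded below.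
\<close>

lemma deriv_P_node_ge:
  obtains L where "L > 0" "\<And>k. exp (- L * \<delta> k powr (-\<rho>)) \<le> cmod (deriv P (z k))"
proof -
  obtain L where L: "L > 0" "\<And>k. exp (- L * \<delta> k powr (-\<rho>)) \<le> cmod (canonical (- {k}) (z k))"
    using canonical_omit_node_ge by metis
  show ?thesis
  proof (rule that[of "L + 1"])
    fix k
    define T where "T a = (\<Sum>i=1..m-1. a ^ i / of_nat i)" for a :: complex
    define g where "g w = - cnj (u k) / (1 - cnj (z k) * w) * exp (T (A k w)) * canonical (- {k}) w" for w
    have zk: "z k \<in> ball 0 1" using in_disc[of k] by simp
    have g: "g holomorphic_on ball 0 1"
      unfolding g_def T_def using denominator_nonzero by (intro holomorphic_intros) auto
    have P_eq: "P w = (w - z k) * g w" if "w \<in> ball 0 1" for w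
    proof -
      have w: "cmod w < 1" using that by simp
      have "P w = (1 - A k w) * exp (T (A k w)) * canonical (- {k}) w"
        using canonical_remove[of k UNIV w] w
        by (simp add: E_def weierstrass_factor_def T_def Compl_eq_Diff_UNIV)
      also have "1 - A k w = (w - z k) * (- cnj (u k) / (1 - cnj (z k) * w))"
      proof -
        have "cnj (u k) * (z k - w) = (w - z k) * (- cnj (u k))" by (simp add: algebra_simps)
        thus ?thesis unfolding one_minus_A[OF w] by (simp only: times_divide_eq_right)
      qed
      finally show ?thesis by (simp add: g_def mult_ac)
    qed
    have "((\<lambda>w. (w - z k) * g w) has_field_derivative (1 - 0) * g (z k) + deriv g (z k) * (z k - z k)) (at (z k))"
      by (intro DERIV_mult DERIV_diff DERIV_ident DERIV_const holomorphic_derivI[OF g open_ball zk])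
    hence "((\<lambda>w. (w - z k) * g w) has_field_derivative g (z k)) (at (z k))" by simp
    hence "(P has_field_derivative g (z k)) (at (z k))"
      by (rule has_field_derivative_transform_within_open[OF _ open_ball zk]) (rule P_eq [symmetric])
    hence deriv: "deriv P (z k) = g (z k)" by (rule DERIV_imp_deriv)
    have "A k (z k) = 1" using one_minus_A[OF in_disc[of k], of k] by simp
    have "cmod (exp (T (A k (z k)))) = exp (\<Sum>i=1..m-1. 1 / real i)"
    proof -
      have "T 1 = complex_of_real (\<Sum>i=1..m-1. 1 / real i)" by (simp add: T_def)
      thus ?thesis unfolding \<open>A k (z k) = 1\<close> by (simp only: norm_exp_eq_Re Re_complex_of_real)
    qed
    also have "\<dots> \<ge> 1" by (simp add: sum_nonneg)
    finally have exp_ge: "1 \<le> cmod (exp (T (A k (z k))))" .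
    have "D k (z k) \<le> 2 * (1 - cmod (z k))" using D_le[of "z k" k] in_disc[of k] by simp
    also have "\<dots> \<le> 2" by simp
    finally have "D k (z k) \<le> 2" .
    with D_ge(3)[OF in_disc[of k], of k] have D: "0 < D k (z k)" "D k (z k) \<le> 2" by auto
    have y: "1 \<le> \<delta> k powr (-\<rho>)"
      using delta_pos delta_le_1 rho by (intro powr_minus_ge_1) auto
    have "exp (- (L + 1) * \<delta> k powr (-\<rho>)) = exp (- (\<delta> k powr (-\<rho>))) * exp (- L * \<delta> k powr (-\<rho>))"
      by (simp add: exp_add [symmetric] algebra_simps)
    also have "\<dots> \<le> 1 / D k (z k) * 1 * cmod (canonical (- {k}) (z k))"
    proof (intro mult_mono L(2))
      have "2 \<le> exp (\<delta> k powr (-\<rho>))" using exp_ge_add_one_self[of "\<delta> k powr (-\<rho>)"] y by linarith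
      hence "exp (- (\<delta> k powr (-\<rho>))) \<le> 1 / 2" by (simp add: exp_minus field_simps)
      also have "\<dots> \<le> 1 / D k (z k)" using D by (intro divide_left_mono) auto
      finally show "exp (- (\<delta> k powr (-\<rho>))) \<le> 1 / D k (z k) * 1" by simp
    qed (use D in auto)
    also have "\<dots> \<le> 1 / D k (z k) * cmod (exp (T (A k (z k)))) * cmod (canonical (- {k}) (z k))"
      using D exp_ge by (intro mult_right_mono mult_left_mono) auto
    also have "\<dots> = cmod (g (z k))"
      by (simp add: g_def norm_mult norm_divide D_def)
    finally show "exp (- (L + 1) * \<delta> k powr (-\<rho>)) \<le> cmod (deriv P (z k))" unfolding deriv .
  qed (use L in auto)
qed

lemma deriv_P_node_nonzero: "deriv P (z k) \<noteq> 0"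
proof -
  obtain L where "\<And>k. exp (- L * \<delta> k powr (-\<rho>)) \<le> cmod (deriv P (z k))"
    using deriv_P_node_ge by metis
  thus ?thesis using exp_gt_zero[of "- L * \<delta> k powr (-\<rho>)"] by (metis norm_zero not_le)
qed

text \<open>
  The numerator vanishes at every zero of \<open>P\<close> near \<open>w\<close>.  By \<open>cmod_le_zero_product\<close> it is at most
  a permitted exponential times the scaled polynomial with these zeros, while by \<open>near_product_le\<close> \<open>P w\<close> is
  not much smaller than that polynomial; the polynomial cancels.  At the zeros themselves
  the bound follows by continuity.
\<close>

lemma division:
  assumes "moderate_growth \<rho> f" and zero: "\<And>k. f (z k) = 0"
  obtains q where "moderate_growth \<rho> q" "\<And>w. cmod w < 1 \<Longrightarrow> f w = q w * P w"
proof -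
  note holo = moderate_growth_holomorphic[OF assms(1)]
  obtain B where B: "B > 0" "\<And>w. cmod w < 1 \<Longrightarrow> cmod (f w) \<le> exp (B * (1 - cmod w) powr (-\<rho>))"
    using moderate_growthE[OF assms(1)] by blast
  obtain K where K: "K > 0"
    "\<And>w. cmod w < 1 \<Longrightarrow> (\<Prod>j\<in>{j. cmod (z j - w) \<le> (1 - cmod w) / 4}. cmod (w - z j) / ((1 - cmod w) / 4))
        \<le> exp (K * (1 - cmod w) powr (-\<rho>)) * cmod (P w)"
    using near_product_le by metis
  \<comment> \<open>Dividing the derivatives gives the continuous value of the quotient at a simple zero.\<close>
  define q where "q = (\<lambda>w. if P w = 0 then deriv f w / deriv P w else f w / P w)"
  have q_holo: "q holomorphic_on ball 0 1"
    unfolding q_def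
  proof (rule holomorphic_divide_simple_zeros[OF holo canonical_holomorphic open_ball])
    fix a :: complex assume "a \<in> ball 0 1" "P a = 0"
    then obtain k where "a = z k" using P_eq_0_iff by auto
    thus "f a = 0 \<and> deriv P a \<noteq> 0" using zero deriv_P_node_nonzero by simp
  qed
  define C' where "C' = B * 2 powr \<rho> + K"
  have off_zeros: "cmod (q w) \<le> exp (C' * (1 - cmod w) powr (-\<rho>))" if w: "cmod w < 1" "P w \<noteq> 0" for w
  proof -
    define x where "x = 1 - cmod w"
    have x: "x > 0" using w by (simp add: x_def)
    define N where "N = {j. cmod (z j - w) \<le> x / 4}"
    have fin: "finite N" unfolding N_def using x by (intro finite_near) (auto simp: x_def)
    have in_disc': "cmod v < 1 \<and> 1 - cmod v \<ge> x / 2" if "cmod (w - v) \<le> x / 2" for v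
      using that norm_triangle_ineq2[of v w] x by (simp add: x_def norm_minus_commute)
    have "cmod (f w) \<le> exp (B * 2 powr \<rho> * x powr (-\<rho>)) * (\<Prod>a\<in>z ` N. cmod (w - a) / (x / 4))"
    proof (rule cmod_le_zero_product[OF _ holo open_ball, where R = "x / 2"])
      show "cball w (x / 2) \<subseteq> ball 0 1" using in_disc' by (auto simp: dist_norm)
      show "a \<in> ball 0 1 \<and> f a = 0" if "a \<in> z ` N" for a
        using that in_disc zero by auto
      show "x / 4 \<le> cmod (v - a)" if "a \<in> z ` N" "cmod (w - v) = x / 2" for a v
      proof -
        have "cmod (w - v) \<le> cmod (w - a) + cmod (a - v)"
          using norm_triangle_ineq[of "w - a" "a - v"] by simp
        moreover have "cmod (w - a) \<le> x / 4"
          using that(1) by (auto simp: N_def norm_minus_commute)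
        ultimately show ?thesis using that(2) by (simp add: norm_minus_commute)
      qed
      fix v assume v: "cmod (w - v) = x / 2"
      hence v': "cmod v < 1" "1 - cmod v \<ge> x / 2" using in_disc'[of v] by auto
      have "(1 - cmod v) powr (-\<rho>) \<le> 2 powr \<rho> * x powr (-\<rho>)"
        using v' x rho by (intro half_powr_minus) auto
      hence "B * (1 - cmod v) powr (-\<rho>) \<le> B * 2 powr \<rho> * x powr (-\<rho>)"
        using B(1) by (simp add: mult.assoc)
      hence "exp (B * (1 - cmod v) powr (-\<rho>)) \<le> exp (B * 2 powr \<rho> * x powr (-\<rho>))" by simp
      thus "cmod (f v) \<le> exp (B * 2 powr \<rho> * x powr (-\<rho>))"
        using B(2)[OF v'(1)] by linarith
    qed (use fin x in auto)
    also have "(\<Prod>a\<in>z ` N. cmod (w - a) / (x / 4)) = (\<Prod>j\<in>N. cmod (w - z j) / (x / 4))"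
      using inj by (subst prod.reindex) (auto intro: inj_on_subset)
    also have "exp (B * 2 powr \<rho> * x powr (-\<rho>)) * \<dots> \<le> exp (B * 2 powr \<rho> * x powr (-\<rho>)) * (exp (K * x powr (-\<rho>)) * cmod (P w))"
      unfolding N_def x_def by (intro mult_left_mono K(2) w) auto
    also have "\<dots> = exp (C' * x powr (-\<rho>)) * cmod (P w)"
      by (simp add: C'_def exp_add ring_distribs)
    finally show ?thesis
      using w by (simp add: q_def norm_divide x_def field_simps)
  qed
  have "moderate_growth \<rho> q"
  proof (rule moderate_growthI[OF q_holo])
    fix a :: complex assume a: "cmod a < 1"
    have "eventually (\<lambda>w. cmod w < 1 \<and> P w \<noteq> 0) (at a)"
    proof -
      define R where "R = (1 - cmod a) / 2"
      have R: "0 < R" "R < 1 - cmod a" using a by (auto simp: R_def field_simps)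
      have "\<not> a islimpt (z ` {k. cmod (z k - a) \<le> R})"
        using finite_near[OF R(2)] by (intro islimpt_finite) auto
      hence "eventually (\<lambda>w. w \<notin> z ` {k. cmod (z k - a) \<le> R}) (at a)"
        by (simp add: islimpt_iff_eventually)
      moreover have "eventually (\<lambda>w. dist w a < R) (at a)"
        using R(1) by (auto simp: eventually_at intro!: exI[of _ R])
      ultimately show ?thesis
      proof eventually_elim
        case (elim w)
        have "cmod w < 1" using elim(2) R(2) norm_triangle_ineq2[of w a] by (simp add: dist_norm)
        moreover have "w \<notin> range z" using elim by (auto simp: dist_norm)
        ultimately show ?case using P_eq_0_iff by blast
      qed
    qed
    hence ev: "eventually (\<lambda>w. cmod (q w) \<le> exp (C' * (1 - cmod w) powr (-\<rho>))) (at a)"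
      by eventually_elim (use off_zeros in blast)
    have "isCont q a"
      using q_holo a by (meson continuous_on_eq_continuous_at holomorphic_on_imp_continuous_on mem_ball_0 open_ball)
    hence "((\<lambda>w. cmod (q w)) \<longlongrightarrow> cmod (q a)) (at a)"
      by (intro tendsto_norm) (simp add: isCont_def)
    moreover have "((\<lambda>w. exp (C' * (1 - cmod w) powr (-\<rho>))) \<longlongrightarrow> exp (C' * (1 - cmod a) powr (-\<rho>))) (at a)"
      using a by (intro tendsto_intros) auto
    ultimately show "cmod (q a) \<le> exp (C' * (1 - cmod a) powr (-\<rho>))"
      by (intro tendsto_le[OF at_neq_bot _ _ ev])
  qed
  moreover have "f w = q w * P w" if "cmod w < 1" for w
    using zero P_eq_0_iff[OF that] by (auto simp: q_def)
  ultimately show ?thesis by (rule that)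
qed

text \<open>
  For \<open>f = P * exp g\<close> with \<open>g' = h\<close> one computes
  \<open>f'' = ((P'' + 2 * h * P') + (h\<^sup>2 + h') * P) * exp g\<close>.  Hence \<open>f'' / f\<close> is holomorphic if and only if
  \<open>P'' + 2 * h * P'\<close> vanishes at the zeros of \<open>P\<close>, which prescribes the values of \<open>h\<close> there.
\<close>

lemma differential_equation:
  obtains a f where "moderate_growth \<rho> a" "f holomorphic_on ball 0 1"
    "\<And>w. w \<in> ball 0 1 \<Longrightarrow> (deriv ^^ 2) f w + a w * f w = 0"
    "{w \<in> ball 0 1. f w = 0} = range z"
proof -
  note P = moderate_growth_P
  note P' = moderate_growth_deriv[OF rho P]
  note P'' = moderate_growth_deriv[OF rho P']
  obtain K where K: "K > 0" "\<And>w. cmod w < 1 \<Longrightarrow> cmod (deriv (deriv P) w) \<le> exp (K * (1 - cmod w) powr (-\<rho>))"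
    using moderate_growthE[OF P''] by blast
  obtain L where L: "L > 0" "\<And>k. exp (- L * \<delta> k powr (-\<rho>)) \<le> cmod (deriv P (z k))"
    using deriv_P_node_ge by metis
  define b where "b k = - deriv (deriv P) (z k) / (2 * deriv P (z k))" for k
  have "cmod (b k) \<le> exp ((K + L) * \<delta> k powr (-\<rho>))" for k
  proof -
    have "cmod (b k) = cmod (deriv (deriv P) (z k)) / (2 * cmod (deriv P (z k)))"
      by (simp add: b_def norm_divide norm_mult)
    also have "\<dots> \<le> exp (K * \<delta> k powr (-\<rho>)) / exp (- L * \<delta> k powr (-\<rho>))"
    proof (intro frac_le)
      show "exp (- L * \<delta> k powr (-\<rho>)) \<le> 2 * cmod (deriv P (z k))"
        using L(2)[of k] norm_ge_zero[of "deriv P (z k)"] by linarith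
    qed (use K(2)[OF in_disc[of k]] in \<open>auto simp: \<delta>_def\<close>)
    also have "\<dots> = exp ((K + L) * \<delta> k powr (-\<rho>))"
      by (simp add: exp_add exp_minus ring_distribs field_simps)
    finally show ?thesis .
  qed
  then obtain h where h: "moderate_growth \<rho> h" "\<And>k. h (z k) = b k"
    using interpolation[of "K + L" b] K(1) L(1) by (metis add_pos_pos)
  define F where "F w = deriv (deriv P) w + (2 * h w) * deriv P w" for w
  have "moderate_growth \<rho> F"
    unfolding F_def
    by (intro moderate_growth_add rho P' P'' h(1) moderate_growth_mult moderate_growth_const)
  moreover have "F (z k) = 0" for k
    using deriv_P_node_nonzero[of k] by (simp add: F_def h(2) b_def)
  ultimately obtain q where q: "moderate_growth \<rho> q" "\<And>w. cmod w < 1 \<Longrightarrow> F w = q w * P w"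
    using division by blast
  define a where "a w = - (q w + (h w * h w + deriv h w))" for w
  have a: "moderate_growth \<rho> a"
    unfolding a_def
    by (intro moderate_growth_uminus moderate_growth_add rho q(1) moderate_growth_mult h(1) moderate_growth_deriv)
  obtain g where g: "\<And>w. w \<in> ball 0 1 \<Longrightarrow> (g has_field_derivative h w) (at w)"
    using holomorphic_convex_primitive'[OF convex_ball open_ball moderate_growth_holomorphic[OF h(1)]]
    by (metis at_within_open open_ball)
  define f where "f w = P w * exp (g w)" for w
  have der: "(\<phi> has_field_derivative deriv \<phi> w) (at w)" if "moderate_growth \<rho> \<phi>" "w \<in> ball 0 1" for \<phi> w
    using holomorphic_derivI[OF moderate_growth_holomorphic[OF that(1)] open_ball that(2)] .
  define f1 where "f1 w = (deriv P w + P w * h w) * exp (g w)" for w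
  note exp_g = DERIV_fun_exp[OF g]
  have f1: "(f has_field_derivative f1 w) (at w)" if w: "w \<in> ball 0 1" for w
  proof -
    have "(f has_field_derivative deriv P w * exp (g w) + exp (g w) * h w * P w) (at w)"
      unfolding f_def by (intro DERIV_mult der P exp_g w)
    thus ?thesis by (simp add: f1_def algebra_simps)
  qed
  have f2: "(f1 has_field_derivative - a w * f w) (at w)" if w: "w \<in> ball 0 1" for w
  proof -
    have "(f1 has_field_derivative
        (deriv (deriv P) w + (deriv P w * h w + deriv h w * P w)) * exp (g w) + (exp (g w) * h w) * (deriv P w + P w * h w)) (at w)"
      unfolding f1_def by (intro DERIV_mult DERIV_add der P P' h(1) exp_g w)
    also have "(deriv (deriv P) w + (deriv P w * h w + deriv h w * P w)) * exp (g w) + (exp (g w) * h w) * (deriv P w + P w * h w)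
        = (F w + (h w * h w + deriv h w) * P w) * exp (g w)"
      by (simp add: F_def algebra_simps)
    also have "\<dots> = - a w * f w"
      using q(2)[of w] w by (simp add: a_def f_def algebra_simps)
    finally show ?thesis .
  qed
  show ?thesis
  proof (rule that[OF a])
    show "f holomorphic_on ball 0 1"
      unfolding holomorphic_on_open[OF open_ball] using f1 by blast
    show "(deriv ^^ 2) f w + a w * f w = 0" if w: "w \<in> ball 0 1" for w
    proof -
      have "(deriv f has_field_derivative - a w * f w) (at w)"
        by (rule has_field_derivative_transform_within_open[OF f2[OF w] open_ball w])
           (simp add: DERIV_imp_deriv[OF f1])
      thus ?thesis by (simp add: numeral_2_eq_2 DERIV_imp_deriv)
    qed
    show "{w \<in> ball 0 1. f w = 0} = range z"
      using P_eq_0_iff in_disc by (auto simp: f_def)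
  qed
qed

end

section \<open>From the counting function to the differential equation\<close>

text \<open>
  Each \<open>z j\<close> is counted for \<open>t\<close> between its distance from \<open>z k\<close> and \<open>r\<close>, which contributes the
  integral of \<open>1 / t\<close> over that interval; the subtracted \<open>1\<close> accounts for \<open>z k\<close> itself.
\<close>

lemma sum_ln_le_integrated_count:
  assumes "finite J" "k \<notin> J" "inj z" "0 < r"
    and near: "\<And>j. j \<in> J \<Longrightarrow> cmod (z j - z k) \<le> r"
  shows "ennreal (\<Sum>j\<in>J. ln (r / cmod (z j - z k))) \<le> integrated_count z (z k) r"
proof -
  define d where "d j = cmod (z j - z k)" for j
  have d: "0 < d j" "d j \<le> r" if "j \<in> J" for j
    using that assms by (auto simp: d_def dest: injD)
  have count: "(\<Sum>j\<in>J. indicator {d j..r} t) \<le> count_disc z (z k) t - 1" if t: "0 < t" "t \<le> r" for t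
  proof -
    have "(\<Sum>j\<in>J. indicator {d j..r} t) = (\<Sum>j\<in>J. of_bool (d j \<le> t) :: ennreal)"
      using t by (intro sum.cong) (auto simp: indicator_def)
    also have "\<dots> = of_nat (card {j\<in>J. d j \<le> t})"
      using \<open>finite J\<close> by (simp add: sum.If_cases of_bool_def Int_def)
    also have "\<dots> = of_nat (card (insert k {j\<in>J. d j \<le> t})) - 1"
      using assms(1,2) by simp
    also have "of_nat (card (insert k {j\<in>J. d j \<le> t})) \<le> count_disc z (z k) t"
    proof -
      have "of_nat (card (insert k {j\<in>J. d j \<le> t})) = emeasure (count_space UNIV) (insert k {j\<in>J. d j \<le> t})"
        using assms(1) by (intro emeasure_count_space_finite [symmetric]) auto
      also have "\<dots> \<le> count_disc z (z k) t"
        unfolding count_disc_def using t by (intro emeasure_mono) (auto simp: d_def)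
      finally show ?thesis .
    qed
    hence "of_nat (card (insert k {j\<in>J. d j \<le> t})) - 1 \<le> count_disc z (z k) t - 1"
      by (rule ennreal_minus_mono) simp
    finally show ?thesis .
  qed
  have "ennreal (\<Sum>j\<in>J. ln (r / cmod (z j - z k))) = (\<Sum>j\<in>J. ennreal (ln r - ln (d j)))"
    using d \<open>0 < r\<close> by (subst sum_ennreal) (auto simp: d_def ln_div intro!: sum.cong)
  also have "\<dots> = (\<Sum>j\<in>J. \<integral>\<^sup>+t. ennreal (1 / t) * indicator {d j..r} t \<partial>lborel)"
  proof (intro sum.cong refl)
    fix j assume j: "j \<in> J"
    show "ennreal (ln r - ln (d j)) = (\<integral>\<^sup>+t. ennreal (1 / t) * indicator {d j..r} t \<partial>lborel)"
      using d[OF j] by (intro nn_integral_FTC_Icc [symmetric]) (auto intro!: derivative_eq_intros)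
  qed
  also have "\<dots> = (\<integral>\<^sup>+t. (\<Sum>j\<in>J. ennreal (1 / t) * indicator {d j..r} t) \<partial>lborel)"
    by (intro nn_integral_sum [symmetric]) auto
  also have "\<dots> \<le> integrated_count z (z k) r"
    unfolding integrated_count_def
  proof (intro nn_integral_mono)
    fix t :: real
    show "(\<Sum>j\<in>J. ennreal (1 / t) * indicator {d j..r} t)
        \<le> (count_disc z (z k) t - 1) / ennreal t * indicator {0<..r} t"
    proof (cases "0 < t \<and> t \<le> r")
      case True
      hence "(\<Sum>j\<in>J. ennreal (1 / t) * indicator {d j..r} t) = (\<Sum>j\<in>J. indicator {d j..r} t) / ennreal t"
        by (simp add: sum_distrib_left [symmetric] divide_ennreal_def inverse_ennreal inverse_eq_divide mult.commute)
      also have "\<dots> \<le> (count_disc z (z k) t - 1) / ennreal t"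
        using count True by (intro divide_right_mono_ennreal) auto
      finally show ?thesis using True by simp
    next
      case False
      have "(\<Sum>j\<in>J. ennreal (1 / t) * indicator {d j..r} t) = 0"
        using False d by (intro sum.neutral) (force simp: indicator_def)
      thus ?thesis by simp
    qed
  qed
  finally show ?thesis .
qed

theorem corollary1:
  fixes \<rho> :: real and z :: "nat \<Rightarrow> complex"
  assumes "\<rho> > 0"
    and "inj z"
    and "\<And>k. z k \<in> ball 0 1"
    and "\<exists>C>0. \<forall>k. integrated_count z (z k) ((1 - cmod (z k)) / 2)
                    \<le> ennreal (C * (1 / (1 - cmod (z k))) powr \<rho>)"
  shows "\<exists>(a :: complex \<Rightarrow> complex) (C' :: real).
           a analytic_on ball 0 1 \<and> C' > 0 \<and>
           (\<forall>r\<in>{0<..<1}. ln_ext (max_modulus r a) \<le> ereal (C' * (1 - r) powr (- \<rho>))) \<and>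
           (\<exists>f. f analytic_on ball 0 1 \<and>
                (\<forall>w\<in>ball 0 1. (deriv ^^ 2) f w + a w * f w = 0) \<and>
                {w \<in> ball 0 1. f w = 0} = range z)"
proof -
  obtain C where C: "C > 0"
    "\<And>k. integrated_count z (z k) ((1 - cmod (z k)) / 2) \<le> ennreal (C * (1 / (1 - cmod (z k))) powr \<rho>)"
    using assms(4) by blast
  interpret sparse_sequence \<rho> C z
  proof
    show z: "cmod (z k) < 1" for k using assms(3)[of k] by simp
    fix J k
    assume J: "finite J" "k \<notin> J" "\<And>j. j \<in> J \<Longrightarrow> cmod (z j - z k) \<le> (1 - cmod (z k)) / 2"
    have "ennreal (\<Sum>j\<in>J. ln ((1 - cmod (z k)) / 2 / cmod (z j - z k))) \<le> integrated_count z (z k) ((1 - cmod (z k)) / 2)"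
      using J z[of k] assms(2) by (intro sum_ln_le_integrated_count) auto
    also note C(2)[of k]
    finally have "(\<Sum>j\<in>J. ln ((1 - cmod (z k)) / 2 / cmod (z j - z k))) \<le> C * (1 / (1 - cmod (z k))) powr \<rho>"
      using C(1) by (subst (asm) ennreal_le_iff) auto
    thus "(\<Sum>j\<in>J. ln ((1 - cmod (z k)) / (2 * cmod (z j - z k)))) \<le> C * (1 - cmod (z k)) powr (-\<rho>)"
      using z[of k] by (simp add: powr_minus powr_divide inverse_eq_divide)
  qed (use assms C in auto)
  obtain a f where a: "moderate_growth \<rho> a" and f: "f holomorphic_on ball 0 1"
      "\<And>w. w \<in> ball 0 1 \<Longrightarrow> (deriv ^^ 2) f w + a w * f w = 0" "{w \<in> ball 0 1. f w = 0} = range z"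
    using differential_equation by blast
  obtain C' where C': "C' > 0" "\<And>w. cmod w < 1 \<Longrightarrow> cmod (a w) \<le> exp (C' * (1 - cmod w) powr (-\<rho>))"
    using moderate_growthE[OF a] by blast
  have "ln_ext (max_modulus r a) \<le> ereal (C' * (1 - r) powr (- \<rho>))" if r: "r \<in> {0<..<1}" for r
  proof -
    have sphere: "of_real r \<in> sphere (0::complex) r" using r by simp
    have le: "cmod (a w) \<le> exp (C' * (1 - r) powr (-\<rho>))" if "w \<in> sphere 0 r" for w
      using C'(2)[of w] that r by simp
    hence upper: "max_modulus r a \<le> exp (C' * (1 - r) powr (-\<rho>))"
      unfolding max_modulus_def using sphere by (intro cSUP_least) auto
    have "cmod (a (of_real r)) \<le> max_modulus r a"
      unfolding max_modulus_def by (rule cSUP_upper[OF sphere]) (rule bdd_aboveI2[OF le])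
    hence "0 \<le> max_modulus r a" using norm_ge_zero order_trans by blast
    hence "ln (max_modulus r a) \<le> C' * (1 - r) powr (-\<rho>)" if "max_modulus r a \<noteq> 0"
      using upper that ln_mono[of "max_modulus r a" "exp (C' * (1 - r) powr (-\<rho>))"] by simp
    thus ?thesis by (simp add: ln_ext_def)
  qed
  moreover have "a analytic_on ball 0 1" "f analytic_on ball 0 1"
    using moderate_growth_holomorphic[OF a] f(1) by (simp_all add: analytic_on_open)
  ultimately show ?thesis using C'(1) f(2,3) by blast
qed

end
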